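(* Let $n,d$ be integers with $n,d\geq 2$. Let $q=p^n$, where $p$ is a prime such that $p^n \equiv 1 \pmod d$ and $p\geq 2(2n-1)^2 d$. Let $H$ be the subgroup of $\mathbb{F}_q^*$ with index $d$ and let $D$ be a union of at most $d/2$ cosets of $H$ in $\mathbb{F}_q^*$. If $f:\mathbb{F}_q \to \mathbb{F}_q$ is a function such that $\mathcal{D}_f \subseteq D$, then there are $a,b \in \mathbb{F}_q$ and an integer $0 \leq j \leq n-1$ such that \[ f(x)=a x^{p^j}+b \qquad \text{for all } x\in\mathbb{F}_q. \]
   Context: $\mathbb{F}_q$ denotes the finite field with $q$ elements and $\mathbb{F}_q^*=\mathbb{F}_q\setminus\{0\}$ its multiplicative group. For a function $f:\mathbb{F}_q\to\mathbb{F}_q$, the set of directions determined by $f$ is \[ \mathcal{D}_f=\left\{\frac{f(x)-f(y)}{x-y} : x,y\in\mathbb{F}_q,\ x\neq y\right\}\subseteq \mathbb{F}_q . \] *)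

theory Defs
  imports
    "HOL-Algebra.Algebraic_Closure_Type"
    "HOL-Algebra.Multiplicative_Group"
    "HOL-Number_Theory.Cong"
    "HOL-Library.Cardinality"
begin

text \<open>\<open>ring_of_type_algebra\<close> is the library's packaging of a type-class ring as a
  HOL-Algebra record; its \<open>mult_of\<close> is the group of nonzero elements, so that subgroups and
  cosets are those of HOL-Algebra.\<close>

definition mult_group :: "'a :: finite_field monoid"
  where "mult_group = Multiplicative_Group.mult_of ring_of_type_algebra"

lemma carrier_mult_group: "carrier (mult_group :: 'a :: finite_field monoid) = UNIV - {0}"
  by (simp add: mult_group_def ring_of_type_algebra_def)

lemma mult_mult_group: "x \<otimes>\<^bsub>mult_group\<^esub> y = x * (y :: 'a :: finite_field)"
  by (simp add: mult_group_def ring_of_type_algebra_def)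

lemma one_mult_group: "\<one>\<^bsub>mult_group\<^esub> = (1 :: 'a :: finite_field)"
  by (simp add: mult_group_def ring_of_type_algebra_def)

lemma group_mult_group: "group (mult_group :: 'a :: finite_field monoid)"
  unfolding mult_group_def by (rule field.field_mult_group) (rule field_from_type_algebra)

definition directions :: "('a \<Rightarrow> 'a) \<Rightarrow> 'a :: field set"
  where "directions f = {(f x - f y) / (x - y) | x y. x \<noteq> y}"

end

theory Submission
  imports Defs "HOL-Number_Theory.Residues"
begin

text \<open>
  Write \<open>q = p\<^sup>n\<close>. The hypotheses give at most \<open>(q - 1) / 2\<close> directions, and this alone forces
  \<open>f\<close> to be affine over the prime field. In the Redei polynomial
  \<open>R(X, Y) = \<Prod>x. (X + x Y - f x)\<close> the coefficients of \<open>X\<^sup>i\<close> with \<open>1 < i < q\<close> have degree at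
  most \<open>q - i\<close> and vanish at all non-directions, so \<open>R(X, y)\<close> is lacunary; for a direction \<open>y\<close> it divides
  \<open>(X\<^sup>q - X) R'(X, y)\<close>, which makes its derivative vanish. Hence \<open>\<partial>R/\<partial>X\<close> depends on \<open>Y\<close> only, and
  evaluating it at \<open>X = f x - x Y\<close> shows that all fibres of \<open>x \<mapsto> f x - x y\<close> have the same size, a
  power of \<open>p\<close>. For directions of minimal fibre size, expanding \<open>R\<close> along \<open>X = c + t (Y - y)\<close> exhibits
  each fibre as the zero set of an affine \<open>p\<close>-polynomial; the remaining directions carry so few points
  that a third point can always be chosen to avoid them.

  Now let \<open>f\<close> be additive with \<open>f 1 = 1\<close>, after scaling. For a generator \<open>\<beta>\<close> of the field the quotients
  \<open>(f \<beta> + t) / (\<beta> + t)\<close>, with \<open>t\<close> in the prime field, all lie in at most half of the cosets of \<open>H\<close>.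
  Stepanov's method shows that this is impossible unless \<open>f \<beta>\<close> is a conjugate \<open>\<beta> ^ (p ^ j)\<close> of \<open>\<beta>\<close>.
  So the subspaces \<open>{x. f x = x ^ (p ^ j)}\<close> and the proper subfields cover the field, and by
  counting one of the former is everything.
\<close>

subsection \<open>Redei polynomials of functions with few directions\<close>

text \<open>The outer variable is X and the inner one is Y, so every coefficient is a polynomial in
  Y; \<open>redei_at f y\<close> is the specialisation Y = y.\<close>

definition redei :: "('a \<Rightarrow> 'a) \<Rightarrow> 'a :: finite_field poly poly"
  where "redei f = (\<Prod>x\<in>UNIV. [:[:- f x, x:], 1:])"

definition redei_at :: "('a \<Rightarrow> 'a) \<Rightarrow> 'a :: finite_field \<Rightarrow> 'a poly"
  where "redei_at f y = (\<Prod>x\<in>UNIV. [:x * y - f x, 1:])"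

text \<open>Abscissae of the graph points on the line of slope \<open>y\<close> through
  \<open>(x, f x)\<close>. Naming the line by one of its points keeps the set nonempty.\<close>

definition fibre :: "('a \<Rightarrow> 'a) \<Rightarrow> 'a :: field \<Rightarrow> 'a \<Rightarrow> 'a set"
  where "fibre f y x = {z. f z - z * y = f x - x * y}"

text \<open>One induction carries all three claims: the bound \<open>card S - i\<close> truncates at
  0, so its step needs the separate vanishing beyond \<open>card S\<close>.\<close>

lemma coeff_prod_linear:
  fixes f :: "'a :: field \<Rightarrow> 'a"
  assumes "finite S"
  shows "poly (poly.coeff (\<Prod>x\<in>S. [:[:- f x, x:], 1:]) i) y = poly.coeff (\<Prod>x\<in>S. [:x * y - f x, 1:]) i
    \<and> degree (poly.coeff (\<Prod>x\<in>S. [:[:- f x, x:], 1:]) i) \<le> card S - i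
    \<and> (card S < i \<longrightarrow> poly.coeff (\<Prod>x\<in>S. [:[:- f x, x:], 1:]) i = 0)"
  using assms
proof (induction S arbitrary: i)
  case empty
  then show ?case by (auto simp: coeff_1)
next
  case (insert a S)
  let ?P = "\<Prod>x\<in>S. [:[:- f x, x:], 1:]"
  have eq: "poly.coeff (\<Prod>x\<in>insert a S. [:[:- f x, x:], 1:]) i
      = [:- f a, a:] * poly.coeff ?P i + (case i of 0 \<Rightarrow> 0 | Suc j \<Rightarrow> poly.coeff ?P j)"
    using insert by (cases i) auto
  have eq2: "poly.coeff (\<Prod>x\<in>insert a S. [:x * y - f x, 1:]) i = (a * y - f a) * poly.coeff (\<Prod>x\<in>S. [:x * y - f x, 1:]) i
     + (case i of 0 \<Rightarrow> 0 | Suc j \<Rightarrow> poly.coeff (\<Prod>x\<in>S. [:x * y - f x, 1:]) j)"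
    using insert by (cases i) auto
  have z: "poly.coeff ?P i = 0" if "i > card S" for i using insert that by blast
  have d1: "degree ([:- f a, a:] * poly.coeff ?P i) \<le> Suc (card S) - i"
  proof (cases "i \<le> card S")
    case True
    have "degree ([:- f a, a:] * poly.coeff ?P i) \<le> degree [:- f a, a:] + degree (poly.coeff ?P i)"
      by (rule degree_mult_le)
    also have "\<dots> \<le> 1 + (card S - i)" using insert.IH[of i] by (intro add_mono) auto
    finally show ?thesis using True by simp
  qed (simp add: z)
  have d2: "degree (case i of 0 \<Rightarrow> 0 | Suc j \<Rightarrow> poly.coeff ?P j) \<le> Suc (card S) - i"
    using insert.IH by (auto split: nat.split)
  have "degree (poly.coeff (\<Prod>x\<in>insert a S. [:[:- f x, x:], 1:]) i) \<le> card (insert a S) - i"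
    unfolding eq using degree_add_le[OF d1 d2] insert by simp
  moreover have "poly (poly.coeff (\<Prod>x\<in>insert a S. [:[:- f x, x:], 1:]) i) y
      = poly.coeff (\<Prod>x\<in>insert a S. [:x * y - f x, 1:]) i"
    unfolding eq eq2 using insert.IH by (auto split: nat.split simp: algebra_simps)
  moreover have "card (insert a S) < i \<longrightarrow> poly.coeff (\<Prod>x\<in>insert a S. [:[:- f x, x:], 1:]) i = 0"
    unfolding eq using insert.hyps by (auto split: nat.split simp: z)
  ultimately show ?case by blast
qed

lemma poly_coeff_redei: "poly (poly.coeff (redei f) i) y = poly.coeff (redei_at f y) i"
  using coeff_prod_linear[of UNIV f i y] by (simp add: redei_def redei_at_def)

lemma degree_coeff_redei: "degree (poly.coeff (redei (f :: 'a \<Rightarrow> 'a :: finite_field)) i) \<le> CARD('a) - i"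
  using coeff_prod_linear[of UNIV f i 0] by (simp add: redei_def)

lemma degree_prod_monic_linear:
  fixes c :: "'b \<Rightarrow> 'a :: idom"
  assumes "finite S"
  shows "degree (\<Prod>x\<in>S. [:c x, 1:]) = card S" "lead_coeff (\<Prod>x\<in>S. [:c x, 1:]) = 1"
    "(\<Prod>x\<in>S. [:c x, 1:]) \<noteq> 0"
proof -
  show nz: "(\<Prod>x\<in>S. [:c x, 1:]) \<noteq> 0" using assms by (simp add: prod_zero_iff)
  show "degree (\<Prod>x\<in>S. [:c x, 1:]) = card S"
    using assms by (subst degree_prod_eq_sum_degree) auto
  show "lead_coeff (\<Prod>x\<in>S. [:c x, 1:]) = 1" by (simp add: lead_coeff_prod)
qed

lemma degree_redei_at: "degree (redei_at (f :: 'a \<Rightarrow> 'a :: finite_field) y) = CARD('a)"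
  and lead_coeff_redei_at: "poly.coeff (redei_at f y) CARD('a) = 1"
  using degree_prod_monic_linear[of "UNIV :: 'a set" "\<lambda>x. x * y - f x"] by (auto simp: redei_at_def)

lemma prod_linear_UNIV:
  "(\<Prod>c\<in>UNIV. [:- c, 1:]) = Polynomial.monom 1 CARD('a) - Polynomial.monom (1 :: 'a :: finite_field) 1"
proof (rule poly_eqI_degree_lead_coeff[where A = UNIV and n = "CARD('a)"])
  have "1 < CARD('a)" using card_mono[of UNIV "{0,1::'a}"] by simp
  then show "poly.coeff (\<Prod>c\<in>UNIV. [:- c, 1:]) CARD('a)
    = poly.coeff (Polynomial.monom 1 CARD('a) - Polynomial.monom (1 :: 'a) 1) CARD('a)"
    using degree_prod_monic_linear[of "UNIV :: 'a set" uminus] by simp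
  show "degree (\<Prod>c\<in>(UNIV :: 'a set). [:- c, 1:]) \<le> CARD('a)"
    using degree_prod_monic_linear[of "UNIV :: 'a set" uminus] by simp
  show "degree (Polynomial.monom 1 CARD('a) - Polynomial.monom (1 :: 'a) 1) \<le> CARD('a)"
    using \<open>1 < CARD('a)\<close> by (intro degree_diff_le) (auto simp: degree_monom_eq)
  fix z :: 'a
  have "poly (\<Prod>c\<in>UNIV. [:- c, 1:]) z = 0" by (auto simp: poly_prod intro!: bexI[of _ z])
  then show "poly (\<Prod>c\<in>UNIV. [:- c, 1:]) z = poly (Polynomial.monom 1 CARD('a) - Polynomial.monom (1 :: 'a) 1) z"
    by (simp add: poly_monom finite_field_power_card_eq_same)
qed auto

lemma directions_iff: "y \<in> directions f \<longleftrightarrow> (\<exists>x z. x \<noteq> z \<and> f x - x * y = f z - z * y)"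
proof -
  have "y = (f x - f z) / (x - z) \<longleftrightarrow> f x - x * y = f z - z * y" if "x \<noteq> z" for x z
    using that by (auto simp: field_simps)
  then show ?thesis unfolding directions_def by blast
qed

text \<open>For such \<open>y\<close> the map sending \<open>x\<close> to \<open>f x - x * y\<close>
  is a permutation, so the factors are all the X - c.\<close>

lemma redei_at_nondirection:
  fixes f :: "'a \<Rightarrow> 'a :: finite_field"
  assumes "y \<notin> directions f"
  shows "redei_at f y = Polynomial.monom 1 CARD('a) - Polynomial.monom 1 1"
proof -
  have "inj (\<lambda>x. f x - x * y)" using assms by (auto simp: directions_iff inj_def)
  then have "bij (\<lambda>x. f x - x * y)" by (simp add: bij_def finite_UNIV_inj_surj)
  then have "(\<Prod>c\<in>UNIV. [:- c, 1:]) = (\<Prod>x\<in>UNIV. [:- (f x - x * y), 1:])"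
    by (rule prod.reindex_bij_betw[symmetric])
  then show ?thesis by (simp add: redei_at_def prod_linear_UNIV)
qed

text \<open>The coefficient has degree at most q - i < q in Y, so its values at all q points
  determine it.\<close>

lemma coeff_redei_eq_0I:
  fixes f :: "'a \<Rightarrow> 'a :: finite_field"
  assumes "1 \<le> i" "\<And>y. poly.coeff (redei_at f y) i = 0"
  shows "poly.coeff (redei f) i = 0"
proof (rule poly_eqI_degree[where A = UNIV])
  show "degree (poly.coeff (redei f) i) < CARD('a)"
    using degree_coeff_redei[of f i] assms(1) zero_less_card_finite[where 'a = 'a] by linarith
qed (use assms(2) zero_less_card_finite[where 'a = 'a] in \<open>auto simp: poly_coeff_redei\<close>)

text \<open>With N directions, the coefficient has degree at most q - i but q - N zeros, one at each
  non-direction.\<close>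

lemma coeff_redei_eq_0:
  fixes f :: "'a \<Rightarrow> 'a :: finite_field"
  assumes "card (directions f) < i" "i < CARD('a)" "i \<noteq> 1"
  shows "poly.coeff (redei f) i = 0"
proof (rule poly_eqI_degree[where A = "- directions f"])
  have "card (- directions f) = CARD('a) - card (directions f)" by (simp add: Compl_eq_Diff_UNIV card_Diff_subset)
  then show "degree (poly.coeff (redei f) i) < card (- directions f)" "degree 0 < card (- directions f)"
    using degree_coeff_redei[of f i] assms by auto
  fix y assume "y \<in> - directions f"
  then show "poly (poly.coeff (redei f) i) y = poly 0 y"
    using redei_at_nondirection[of y f] assms by (simp add: poly_coeff_redei)
qed

lemma directions_nonempty: "directions (f :: 'a \<Rightarrow> 'a :: finite_field) \<noteq> {}"
  unfolding directions_def using zero_neq_one by blast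

lemma degree_redei_at_minus_monom:
  fixes f :: "'a \<Rightarrow> 'a :: finite_field"
  shows "degree (redei_at f y - Polynomial.monom 1 CARD('a)) \<le> card (directions f)"
proof (rule degree_le, intro allI impI)
  fix i assume i: "card (directions f) < i"
  have N: "1 \<le> card (directions f)"
    using directions_nonempty[of f] by (simp add: Suc_leI card_gt_0_iff)
  show "poly.coeff (redei_at f y - Polynomial.monom 1 CARD('a)) i = 0"
  proof (cases "i < CARD('a)")
    case True
    then have "poly.coeff (redei_at f y) i = 0"
      using coeff_redei_eq_0[of f i] i N poly_coeff_redei[of f i y] by simp
    then show ?thesis using True by simp
  next
    case False
    then show ?thesis
      using lead_coeff_redei_at[of f y] degree_redei_at[of f y]
      by (cases "i = CARD('a)") (auto simp: coeff_eq_0)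
  qed
qed

section \<open>The derivative of the Redei polynomial\<close>

lemma degree_pderiv_le: "degree (pderiv P) \<le> degree (P :: 'a :: idom poly) - 1"
proof (rule degree_le, intro allI impI)
  fix i assume "degree P - 1 < i"
  then show "poly.coeff (pderiv P) i = 0" by (simp add: coeff_pderiv coeff_eq_0)
qed

text \<open>Each summand of the derivative lacks exactly one linear factor, and \<open>h\<close>
  supplies it.\<close>

lemma prod_linear_dvd_mult_pderiv:
  fixes c :: "'b \<Rightarrow> 'a :: field"
  assumes "finite S" "\<And>x. x \<in> S \<Longrightarrow> [:c x, 1:] dvd h"
  shows "(\<Prod>x\<in>S. [:c x, 1:]) dvd h * pderiv (\<Prod>x\<in>S. [:c x, 1:])"
proof -
  have "(\<Prod>x\<in>S. [:c x, 1:]) dvd h * (\<Prod>x\<in>S - {a}. [:c x, 1:])" if "a \<in> S" for a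
    using mult_dvd_mono[OF assms(2)[OF that] dvd_refl] prod.remove[OF assms(1) that] by metis
  then show ?thesis
    unfolding pderiv_prod sum_distrib_left
    by (intro dvd_sum) (auto simp: pderiv_pCons)
qed

lemma of_nat_CARD_eq_0: "of_nat CARD('a) = (0 :: 'a :: finite_field)"
  using CHAR_dvd_CARD[where 'a='a] by (simp add: of_nat_eq_0_iff_char_dvd)

lemma pderiv_redei_at_direction:
  fixes f :: "'a \<Rightarrow> 'a :: finite_field"
  assumes "2 * card (directions f) < CARD('a)" and y: "y \<in> directions f"
  shows "pderiv (redei_at f y) = 0"
proof (rule ccontr)
  assume nz: "pderiv (redei_at f y) \<noteq> 0"
  let ?X = "Polynomial.monom (1::'a) 1" and ?R = "redei_at f y" and ?N = "card (directions f)"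
  let ?Q = "Polynomial.monom (1::'a) CARD('a)"
  have N: "1 \<le> ?N" using y by (metis One_nat_def Suc_leI card_gt_0_iff empty_iff finite)
  define g where "g = ?R - ?Q"
  have deg_g: "degree g \<le> ?N" unfolding g_def by (rule degree_redei_at_minus_monom)
  have "?R dvd (?Q - ?X) * pderiv ?R"
    unfolding redei_at_def
  proof (rule prod_linear_dvd_mult_pderiv)
    fix x :: 'a
    have "[:- (f x - x * y), 1:] dvd (\<Prod>c\<in>UNIV. [:- c, 1:])"
      by (rule dvd_prodI) auto
    then show "[:x * y - f x, 1:] dvd ?Q - ?X" by (simp add: prod_linear_UNIV)
  qed simp
  \<comment> \<open>Modulo \<open>?R\<close> the power X^q equals \<open>- g\<close>. This brings
    the degree down to at most 2 N - 1 < q, so the multiple of \<open>?R\<close> must be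
    zero.\<close>
  then have "?R dvd ?R * pderiv ?R - (?Q - ?X) * pderiv ?R" by simp
  also have "\<dots> = (?X + g) * pderiv ?R" by (simp add: g_def algebra_simps)
  finally have dvd: "?R dvd (?X + g) * pderiv ?R" .
  have pd: "pderiv ?R = pderiv g"
    by (simp add: g_def pderiv_diff pderiv_monom of_nat_CARD_eq_0)
  have "degree ((?X + g) * pderiv ?R) \<le> degree (?X + g) + degree (pderiv g)"
    by (simp add: pd degree_mult_le)
  also have "\<dots> \<le> ?N + (?N - 1)"
  proof (intro add_mono)
    show "degree (?X + g) \<le> ?N" using deg_g N by (intro degree_add_le) (auto simp: degree_monom_eq)
    show "degree (pderiv g) \<le> ?N - 1" using degree_pderiv_le[of g] deg_g by simp
  qed
  also have "\<dots> < degree ?R" using assms N by (simp add: degree_redei_at)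
  finally have "(?X + g) * pderiv ?R = 0" using dvd dvd_imp_degree_le by (metis leD)
  then have "?X + g = 0" using nz by simp
  then have eq: "?R = ?Q - ?X" by (simp add: g_def algebra_simps eq_neg_iff_add_eq_0)
  obtain x z where xz: "x \<noteq> z" "f x - x * y = f z - z * y"
    using y by (auto simp: directions_iff)
  then have eqxz: "x * y - f x = z * y - f z" by (simp add: algebra_simps)
  \<comment> \<open>A direction yields a repeated root, where the derivative vanishes; but X^q - X
    has derivative -1.\<close>
  have "?R = [:x * y - f x, 1:] * ([:z * y - f z, 1:] * (\<Prod>x\<in>UNIV - {x} - {z}. [:x * y - f x, 1:]))"
    unfolding redei_at_def using xz by (subst prod.remove[of _ x], simp, simp, subst prod.remove[of _ z]) auto
  then obtain h where h: "?R = [:x * y - f x, 1:] * ([:x * y - f x, 1:] * h)" using eqxz by simp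
  have "poly (pderiv ?R) (f x - x * y) = 0"
    unfolding h pderiv_mult poly_add poly_mult by simp
  moreover have "pderiv ?R = - 1"
    by (simp add: eq pderiv_diff pderiv_monom of_nat_CARD_eq_0 monom_0 flip: one_pCons)
  ultimately show False by simp
qed

text \<open>Coefficients with index at least 2 and prime to p vanish at every \<open>y\<close>: at
  directions because the derivative is zero, elsewhere because the polynomial is X^q - X and p
  divides q.\<close>

lemma pderiv_redei:
  fixes f :: "'a \<Rightarrow> 'a :: finite_field"
  assumes "2 * card (directions f) < CARD('a)"
  shows "pderiv (redei f) = [:poly.coeff (redei f) 1:]"
proof (rule poly_eqI)
  fix i
  show "poly.coeff (pderiv (redei f)) i = poly.coeff [:poly.coeff (redei f) 1:] i"
  proof (cases i)
    case (Suc j)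
    have "of_nat (Suc i) * poly.coeff (redei f) (Suc i) = 0"
    proof (cases "of_nat (Suc i) = (0 :: 'a)")
      case True
      then have "of_nat (Suc i) = (0 :: 'a poly)" by (metis of_nat_poly pCons_0_0)
      then show ?thesis by simp
    next
      case False
      have "poly.coeff (redei_at f y) (Suc i) = 0" for y
      proof (cases "y \<in> directions f")
        case True
        then have "poly.coeff (pderiv (redei_at f y)) i = 0"
          using pderiv_redei_at_direction[OF assms] by simp
        then show ?thesis using False by (simp add: coeff_pderiv)
      next
        case nd: False
        have "Suc i \<noteq> CARD('a)" using False of_nat_CARD_eq_0[where 'a = 'a] by metis
        then show ?thesis using nd Suc by (simp add: redei_at_nondirection)
      qed
      then have "poly.coeff (redei f) (Suc i) = 0" by (intro coeff_redei_eq_0I) auto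
      then show ?thesis by simp
    qed
    then show ?thesis by (simp add: coeff_pderiv Suc)
  qed (simp add: coeff_pderiv)
qed

text \<open>Substituting the root X = f x - x Y into the derivative kills all summands except the
  one that omits the factor of \<open>x\<close>. The left side does not involve \<open>x\<close>,
  which is the source of equal fibre sizes.\<close>

lemma coeff_1_redei:
  fixes f :: "'a \<Rightarrow> 'a :: finite_field"
  assumes "2 * card (directions f) < CARD('a)"
  shows "poly.coeff (redei f) 1 = (\<Prod>z\<in>UNIV - {x}. [:f x - f z, z - x:])"
proof -
  have "poly.coeff (redei f) 1 = poly (pderiv (redei f)) [:f x, - x:]"
    by (simp add: pderiv_redei[OF assms])
  also have "\<dots> = (\<Sum>a\<in>UNIV. \<Prod>z\<in>UNIV - {a}. [:f x - f z, z - x:])"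
    by (simp add: redei_def pderiv_prod poly_sum poly_prod pderiv_pCons)
  also have "\<dots> = (\<Sum>a\<in>{x}. \<Prod>z\<in>UNIV - {a}. [:f x - f z, z - x:])"
    by (rule sum.mono_neutral_right) (auto intro!: prod_zero)
  finally show ?thesis by simp
qed

section \<open>Fibre sizes as orders of zeros\<close>

lemma order_prod:
  fixes h :: "'b \<Rightarrow> 'a :: idom poly"
  assumes "finite S" "\<And>x. x \<in> S \<Longrightarrow> h x \<noteq> 0"
  shows "Polynomial.order a (\<Prod>x\<in>S. h x) = (\<Sum>x\<in>S. Polynomial.order a (h x))"
  using assms
proof (induction S)
  case (insert x S)
  then show ?case by (subst prod.insert) (auto simp: Polynomial.order_mult prod_zero_iff)
qed simp

lemma order_linear:
  fixes a b y :: "'a :: field"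
  assumes "b \<noteq> 0"
  shows "Polynomial.order y [:a, b:] = (if a + y * b = 0 then 1 else 0)"
proof (cases "a + y * b = 0")
  case True
  then have "[:a, b:] = smult b [:- y, 1:]" by (simp add: add_eq_0_iff2 mult.commute)
  then show ?thesis using True assms order_power_n_n[of y 1] by (simp add: Polynomial.order_smult del: smult_pCons)
qed (use assms in \<open>auto intro: order_0I\<close>)

text \<open>In \<open>coeff_1_redei\<close> the linear factor of \<open>z\<close> vanishes at
  \<open>y\<close> exactly when \<open>z\<close> lies in the fibre; \<open>Suc\<close> counts
  \<open>x\<close> itself.\<close>

lemma card_fibre_eq_order:
  fixes f :: "'a \<Rightarrow> 'a :: finite_field"
  assumes "2 * card (directions f) < CARD('a)"
  shows "card (fibre f y x) = Suc (Polynomial.order y (poly.coeff (redei f) 1))"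
proof -
  have eq: "f x - f z + y * (z - x) = 0 \<longleftrightarrow> z \<in> fibre f y x" for z
    by (auto simp: fibre_def algebra_simps)
  have "Polynomial.order y (poly.coeff (redei f) 1)
      = (\<Sum>z\<in>UNIV - {x}. Polynomial.order y [:f x - f z, z - x:])"
    unfolding coeff_1_redei[OF assms, of x] by (rule order_prod) auto
  also have "\<dots> = (\<Sum>z\<in>UNIV - {x}. if z \<in> fibre f y x then 1 else 0)"
    by (intro sum.cong refl) (simp add: order_linear eq)
  also have "\<dots> = card (fibre f y x - {x})"
    by (subst sum.If_cases) (auto intro!: arg_cong[where f = card])
  finally show ?thesis
    using card.remove[of "fibre f y x" x] by (simp add: fibre_def)
qed

lemma card_fibre:
  fixes f :: "'a \<Rightarrow> 'a :: finite_field"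
  assumes "2 * card (directions f) < CARD('a)"
  shows "card (fibre f y x) = card (fibre f y 0)"
  using card_fibre_eq_order[OF assms] by simp

lemma redei_at_eq_power:
  fixes f :: "'a \<Rightarrow> 'a :: finite_field"
  assumes "2 * card (directions f) < CARD('a)"
  shows "redei_at f y = (\<Prod>c\<in>range (\<lambda>x. f x - x * y). [:- c, 1:]) ^ card (fibre f y 0)"
proof -
  let ?g = "\<lambda>x. f x - x * y"
  have "redei_at f y = (\<Prod>x\<in>UNIV. [:- ?g x, 1:])" by (simp add: redei_at_def)
  also have "\<dots> = (\<Prod>c\<in>range ?g. \<Prod>x | x \<in> UNIV \<and> ?g x = c. [:- ?g x, 1:])"
    by (rule prod.image_gen) simp
  also have "\<dots> = (\<Prod>c\<in>range ?g. [:- c, 1:] ^ card (fibre f y 0))"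
  proof (rule prod.cong[OF refl])
    fix c assume "c \<in> range ?g"
    then obtain a where a: "c = ?g a" by auto
    have "(\<Prod>x | x \<in> UNIV \<and> ?g x = c. [:- ?g x, 1:]) = (\<Prod>x\<in>fibre f y a. [:- c, 1:])"
      by (intro prod.cong) (auto simp: fibre_def a)
    then show "(\<Prod>x | x \<in> UNIV \<and> ?g x = c. [:- ?g x, 1:]) = [:- c, 1:] ^ card (fibre f y 0)"
      using card_fibre[OF assms, of y a] by simp
  qed
  finally show ?thesis by (simp add: prod_power_distrib)
qed

lemma card_range_mult_card_fibre:
  fixes f :: "'a \<Rightarrow> 'a :: finite_field"
  assumes "2 * card (directions f) < CARD('a)"
  shows "card (range (\<lambda>x. f x - x * y)) * card (fibre f y 0) = CARD('a)"
proof -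
  have "degree (redei_at f y) = card (fibre f y 0) * degree (\<Prod>c\<in>range (\<lambda>x. f x - x * y). [:- c, 1:])"
    unfolding redei_at_eq_power[OF assms] by (rule degree_power_eq) (simp add: prod_zero_iff)
  also have "degree (\<Prod>c\<in>range (\<lambda>x. f x - x * y). [:- c, 1:]) = card (range (\<lambda>x. f x - x * y))"
    using degree_prod_monic_linear[of "range (\<lambda>x. f x - x * y)" uminus] by simp
  finally show ?thesis by (simp add: degree_redei_at mult.commute)
qed

section \<open>Sparsity, and counting directions against fibre sizes\<close>

lemma coeff_power_CHAR_eq_0:
  fixes h :: "'a :: field_prime_char poly"
  assumes "\<not> CHAR('a) ^ e dvd i"
  shows "poly.coeff (h ^ (CHAR('a) ^ e)) i = 0"
proof -
  let ?s = "CHAR('a) ^ e"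
  have "h ^ ?s = (\<Sum>i\<le>degree h. Polynomial.monom (poly.coeff h i) i) ^ ?s"
    by (simp only: poly_as_sum_of_monoms)
  also have "\<dots> = (\<Sum>i\<le>degree h. Polynomial.monom (poly.coeff h i) i ^ ?s)"
    by (rule freshmans_dream_sum'[where n = e]) simp_all
  also have "poly.coeff \<dots> i = (\<Sum>j\<le>degree h. 0)"
    unfolding coeff_sum using assms by (intro sum.cong) (auto simp: monom_power)
  finally show ?thesis by simp
qed

text \<open>At a direction the specialisation is a p^e-th power, at any other \<open>y\<close> it is
  X^q - X; both have only the exponent 1 and multiples of p^e.\<close>

lemma coeff_redei_sparse:
  fixes f :: "'a \<Rightarrow> 'a :: finite_field"
  assumes "2 * card (directions f) < CARD('a)"
    and s: "\<And>y. y \<in> directions f \<Longrightarrow> CHAR('a) ^ e dvd card (fibre f y 0)"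
    and i: "i \<noteq> 1" "\<not> CHAR('a) ^ e dvd i"
  shows "poly.coeff (redei f) i = 0"
proof (rule coeff_redei_eq_0I)
  show "1 \<le> i" using i(2) by (cases i) auto
  obtain y0 where "y0 \<in> directions f" using directions_nonempty[of f] by blast
  then have "CHAR('a) ^ e dvd CARD('a)"
    using s card_range_mult_card_fibre[OF assms(1), of y0] by (metis dvd_mult)
  then have iq: "i \<noteq> CARD('a)" using i by auto
  fix y
  show "poly.coeff (redei_at f y) i = 0"
  proof (cases "y \<in> directions f")
    case True
    then obtain k where "card (fibre f y 0) = k * CHAR('a) ^ e"
      using s by (metis dvd_div_mult_self)
    then show ?thesis
      using coeff_power_CHAR_eq_0[OF i(2)] by (simp add: redei_at_eq_power[OF assms(1)] power_mult)
  qed (use i iq in \<open>simp add: redei_at_nondirection\<close>)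
qed

text \<open>The squarefree part \<open>h\<close> divides both \<open>redei_at f y\<close> and X^q -
  X, hence their difference. That difference has derivative 1, so it is nonzero, and its degree is
  at most the number of directions.\<close>

lemma CARD_le_card_directions_mult:
  fixes f :: "'a \<Rightarrow> 'a :: finite_field"
  assumes "2 * card (directions f) < CARD('a)" and y: "y \<in> directions f"
  shows "CARD('a) \<le> card (directions f) * card (fibre f y 0)"
proof -
  let ?V = "range (\<lambda>x. f x - x * y)" and ?X = "Polynomial.monom (1::'a) 1"
  let ?Q = "Polynomial.monom (1::'a) CARD('a)"
  define h where "h = (\<Prod>c\<in>?V. [:- c, 1:])"
  have "card (fibre f y 0) > 0" using card_fibre_eq_order[OF assms(1)] by simp
  then have "h dvd redei_at f y"
    by (simp add: redei_at_eq_power[OF assms(1)] h_def dvd_power)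
  moreover have "h dvd ?Q - ?X"
    unfolding h_def prod_linear_UNIV[symmetric] by (rule prod_dvd_prod_subset) auto
  ultimately have "h dvd redei_at f y - (?Q - ?X)" by (rule dvd_diff)
  also have "\<dots> = (redei_at f y - ?Q) + ?X" by simp
  finally have dvd: "h dvd (redei_at f y - ?Q) + ?X" .
  have "pderiv ((redei_at f y - ?Q) + ?X) = 1"
    using pderiv_redei_at_direction[OF assms]
    by (simp add: pderiv_diff pderiv_add pderiv_monom of_nat_CARD_eq_0 monom_0 flip: one_pCons)
  then have "(redei_at f y - ?Q) + ?X \<noteq> 0" by auto
  then have "degree h \<le> degree ((redei_at f y - ?Q) + ?X)" using dvd by (rule dvd_imp_degree_le[rotated])
  also have "\<dots> \<le> card (directions f)"
    using degree_redei_at_minus_monom[of f y] directions_nonempty[of f]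
    by (intro degree_add_le) (auto simp: degree_monom_eq Suc_leI card_gt_0_iff)
  finally have "card ?V \<le> card (directions f)"
    using degree_prod_monic_linear(1)[of ?V uminus] by (simp add: h_def)
  then show ?thesis
    using card_range_mult_card_fibre[OF assms(1), of y] by (metis mult_le_mono1)
qed

text \<open>Every point of the graph other than \<open>(0, f 0)\<close> lies on exactly one line
  through it whose slope is a direction.\<close>

lemma sum_card_fibre:
  fixes f :: "'a \<Rightarrow> 'a :: finite_field"
  shows "(\<Sum>y\<in>directions f. card (fibre f y 0) - 1) = CARD('a) - 1"
proof -
  have "UNIV - {0} = (\<Union>y\<in>directions f. fibre f y 0 - {0})"
  proof (intro equalityI subsetI)
    fix x :: 'a assume "x \<in> UNIV - {0}"
    then have "x \<noteq> 0" by simp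
    then have "(f x - f 0) / (x - 0) \<in> directions f" "x \<in> fibre f ((f x - f 0) / (x - 0)) 0 - {0}"
      unfolding directions_def fibre_def by blast (use \<open>x \<noteq> 0\<close> in simp)
    then show "x \<in> (\<Union>y\<in>directions f. fibre f y 0 - {0})" by blast
  qed auto
  then have "CARD('a) - 1 = card (\<Union>y\<in>directions f. fibre f y 0 - {0})"
    by (metis card_Diff_singleton UNIV_I)
  also have "\<dots> = (\<Sum>y\<in>directions f. card (fibre f y 0 - {0}))"
  proof (rule card_UN_disjoint)
    have "y = j" if "x \<in> fibre f y 0 - {0}" "x \<in> fibre f j 0 - {0}" for x y j
      using that unfolding fibre_def by (simp flip: right_diff_distrib) (metis diff_left_imp_eq mult_left_cancel)
    then show "\<forall>y\<in>directions f. \<forall>j\<in>directions f. y \<noteq> j \<longrightarrow> (fibre f y 0 - {0}) \<inter> (fibre f j 0 - {0}) = {}"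
      by blast
  qed auto
  finally show ?thesis by (simp add: fibre_def)
qed

subsection \<open>Affinity over the prime field\<close>

lemma card_fibre_eq_CHAR_power:
  fixes f :: "'a \<Rightarrow> 'a :: finite_field"
  assumes "CARD('a) = CHAR('a) ^ n" "2 * card (directions f) < CARD('a)"
  obtains e where "card (fibre f y 0) = CHAR('a) ^ e"
proof -
  have "card (fibre f y 0) dvd CHAR('a) ^ n"
    using card_range_mult_card_fibre[OF assms(2), of y] assms(1) by (metis dvd_triv_right)
  then show ?thesis using that divides_primepow_nat[OF CHAR_prime] by metis
qed

lemma card_fibre_gt_1:
  fixes f :: "'a \<Rightarrow> 'a :: finite_field"
  assumes "2 * card (directions f) < CARD('a)" "y \<in> directions f"
  shows "1 < card (fibre f y 0)"
proof -
  obtain x z where "x \<noteq> z" "f x - x * y = f z - z * y"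
    using assms(2) by (auto simp: directions_iff)
  then have "card {x, z} \<le> card (fibre f y x)" by (intro card_mono) (auto simp: fibre_def)
  then show ?thesis using \<open>x \<noteq> z\<close> card_fibre[OF assms(1), of y x] by simp
qed

text \<open>Fibre sizes are powers of p, so a non-minimal one is at least \<open>p * s\<close>.
  Playing this against the two counts of directions above leaves little room for large
  fibres.\<close>

lemma sum_card_large_fibres:
  fixes f :: "'a \<Rightarrow> 'a :: finite_field"
  assumes q: "CARD('a) = CHAR('a) ^ n" and N: "2 * card (directions f) < CARD('a)"
    and s: "s = card (fibre f y0 0)" "y0 \<in> directions f"
    and min: "\<And>y. y \<in> directions f \<Longrightarrow> s \<le> card (fibre f y 0)"
  shows "(CHAR('a) - 1) * (\<Sum>y\<in>{y \<in> directions f. card (fibre f y 0) \<noteq> s}. card (fibre f y 0)) \<le> CARD('a)"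
proof -
  let ?p = "CHAR('a)" and ?m = "\<lambda>y. card (fibre f y 0)"
  define Bd where "Bd = {y \<in> directions f. ?m y \<noteq> s}"
  define Gd where "Gd = {y \<in> directions f. ?m y = s}"
  define B where "B = (\<Sum>y\<in>Bd. ?m y)"
  have p: "prime ?p" by simp
  have split: "directions f = Gd \<union> Bd" "Gd \<inter> Bd = {}" by (auto simp: Gd_def Bd_def)
  obtain e where e: "s = ?p ^ e" using card_fibre_eq_CHAR_power[OF q N] s(1) by metis
  have s1: "1 < s" using card_fibre_gt_1[OF N s(2)] s(1) by simp
  have "e \<noteq> 0" using s1 e by (cases e) auto
  then have sp: "?p \<le> s" using e p by (metis One_nat_def Suc_leI bot_nat_0.not_eq_extremum power_increasing power_one_right prime_ge_1_nat)
  have large: "?p * s \<le> ?m y" if "y \<in> Bd" for y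
  proof -
    obtain k where k: "?m y = ?p ^ k" using card_fibre_eq_CHAR_power[OF q N] by metis
    have "s < ?m y" using that min[of y] by (auto simp: Bd_def)
    then have "e < k" using e k p by (metis power_less_imp_less_exp prime_gt_1_nat)
    then have "?p ^ Suc e \<le> ?p ^ k" using p by (intro power_increasing) (auto simp: Suc_leI prime_ge_1_nat)
    then show ?thesis using e k by simp
  qed
  have "card Bd * (?p * s) = (\<Sum>y\<in>Bd. ?p * s)" by simp
  also have "\<dots> \<le> B" unfolding B_def by (intro sum_mono large)
  finally have 1: "card Bd * (?p * s) \<le> B" .
  have Nsum: "card (directions f) = card Gd + card Bd"
    using split by (metis card_Un_disjoint finite)
  have "CARD('a) \<le> (card Gd + card Bd) * s"
    using CARD_le_card_directions_mult[OF N s(2)] s(1) Nsum by simp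
  then have 3: "int CARD('a) \<le> (int (card Gd) + int (card Bd)) * int s"
    by (metis of_nat_add of_nat_le_iff of_nat_mult)
  have "int (CARD('a) - 1) = (\<Sum>y\<in>directions f. int (?m y - 1))"
    using sum_card_fibre[of f] by (metis of_nat_sum)
  then have "int CARD('a) - 1 = (\<Sum>y\<in>directions f. int (?m y) - 1)"
    using card_fibre_gt_1[OF N] zero_less_card_finite[where 'a = 'a] by (simp add: of_nat_diff less_imp_le)
  also have "\<dots> = (\<Sum>y\<in>Gd. int (?m y) - 1) + (\<Sum>y\<in>Bd. int (?m y) - 1)"
    using split by (metis finite sum.union_disjoint)
  also have "(\<Sum>y\<in>Gd. int (?m y) - 1) = int (card Gd) * (int s - 1)"
    by (simp add: Gd_def)
  also have "(\<Sum>y\<in>Bd. int (?m y) - 1) = int B - int (card Bd)" by (simp add: B_def sum_subtractf)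
  finally have 2: "int CARD('a) - 1 = int (card Gd) * (int s - 1) + (int B - int (card Bd))" .
  \<comment> \<open>Eliminating \<open>card Gd\<close> gives s B <= q + s^2 |Bd|; with p s |Bd| <= B
    and p <= s this becomes (p - 1) B <= q.\<close>
  have "(int s - 1) * int CARD('a) \<le> (int s - 1) * ((int (card Gd) + int (card Bd)) * int s)"
    using 3 s1 by (intro mult_left_mono) auto
  also have "\<dots> = int s * (int CARD('a) - 1 - int B + int (card Bd)) + (int s - 1) * int (card Bd) * int s"
    by (simp only: 2) (simp add: algebra_simps)
  finally have "int s * int B \<le> int CARD('a) + int s * (int s * int (card Bd))"
    by (simp add: algebra_simps)
  then have "int ?p * (int s * int B) \<le> int ?p * int CARD('a) + int ?p * (int s * (int s * int (card Bd)))"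
    by (metis distrib_left mult_left_mono of_nat_0_le_iff)
  moreover have "int s * (int (card Bd) * (int ?p * int s)) \<le> int s * int B"
    using 1 by (intro mult_left_mono) (metis of_nat_le_iff of_nat_mult, simp)
  ultimately have "int s * ((int ?p - 1) * int B) \<le> int ?p * int CARD('a)"
    by (simp add: algebra_simps)
  also have "\<dots> \<le> int s * int CARD('a)" using sp by (intro mult_right_mono) auto
  finally have "(int ?p - 1) * int B \<le> int CARD('a)" using s1 by simp
  then have "int ((?p - 1) * B) \<le> int CARD('a)"
    using prime_ge_1_nat[OF p] by (simp add: of_nat_diff)
  then show ?thesis unfolding B_def Bd_def by linarith
qed

section \<open>Fibres are closed under affine combinations over the prime field\<close>

lemma directions_shear:
  "directions (\<lambda>x. f x - x * y) = (\<lambda>v. v - y) ` directions (f :: 'a \<Rightarrow> 'a :: field)"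
proof -
  have "v \<in> directions (\<lambda>x. f x - x * y) \<longleftrightarrow> v + y \<in> directions f" for v
    by (simp add: directions_iff algebra_simps)
  then show ?thesis by (force simp: image_iff)
qed

lemma fibre_shear: "fibre (\<lambda>x. f x - x * y) v x = fibre f (v + y) x"
  by (auto simp: fibre_def algebra_simps)

text \<open>Only the terms of order 0 and 1 in \<open>b\<close> reach degree \<open>s\<close>. The
  slope \<open>w\<close> is chosen before \<open>b\<close>, since \<open>b\<close> will be a varying
  \<open>t ^ s\<close>.\<close>

lemma coeff_mult_power_binomial:
  fixes r :: "'a :: comm_ring_1 poly"
  assumes "0 < s"
  shows "\<exists>w. \<forall>b. poly.coeff (r * ([:a:] + Polynomial.monom b s) ^ j) s = poly.coeff r s * a ^ j + w * b"
proof -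
  have step: "poly.coeff (Q * ([:a:] + Polynomial.monom b s)) m
      = a * poly.coeff Q m + (if s \<le> m then b * poly.coeff Q (m - s) else 0)" for Q b m
    by (subst mult.commute) (simp add: distrib_right coeff_monom_mult)
  have low: "poly.coeff (r * ([:a:] + Polynomial.monom b s) ^ j) 0 = poly.coeff r 0 * a ^ j" for b j
  proof (induction j)
    case (Suc j)
    have "r * ([:a:] + Polynomial.monom b s) ^ Suc j = (r * ([:a:] + Polynomial.monom b s) ^ j) * ([:a:] + Polynomial.monom b s)"
      by (simp add: mult_ac)
    then show ?case using assms by (simp only: step Suc) simp
  qed simp
  show ?thesis
  proof (induction j)
    case 0
    show ?case by (intro exI[of _ 0]) simp
  next
    case (Suc j)
    then obtain w where w: "\<And>b. poly.coeff (r * ([:a:] + Polynomial.monom b s) ^ j) s = poly.coeff r s * a ^ j + w * b"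
      by blast
    have "r * ([:a:] + Polynomial.monom b s) ^ Suc j = (r * ([:a:] + Polynomial.monom b s) ^ j) * ([:a:] + Polynomial.monom b s)" for b
      by (simp add: mult_ac)
    then have "poly.coeff (r * ([:a:] + Polynomial.monom b s) ^ Suc j) s
      = poly.coeff r s * a ^ Suc j + (a * w + poly.coeff r 0 * a ^ j) * b" for b
      by (simp only: step w low diff_self_eq_0 order_refl if_True) (simp add: algebra_simps)
    then show ?case by blast
  qed
qed

text \<open>The index 1 contributes the part linear in \<open>t\<close>. For i = s j, Frobenius
  turns the power into (c^s + t^s Y^s)^j, which contributes a constant and a multiple of
  \<open>t ^ s\<close>.\<close>

lemma coeff_poly_sparse:
  fixes P :: "'a :: field_prime_char poly poly" and e :: nat
  defines "s \<equiv> CHAR('a) ^ e"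
  assumes "\<And>i. i \<noteq> 1 \<Longrightarrow> \<not> s dvd i \<Longrightarrow> poly.coeff P i = 0"
  shows "\<exists>u v w. \<forall>t. poly.coeff (poly P [:c, t:]) s = u + v * t + w * t ^ s"
proof -
  have s0: "0 < s" by (simp add: s_def)
  have "\<exists>u v w. \<forall>t. poly.coeff (poly.coeff P i * [:c, t:] ^ i) s = u + v * t + w * t ^ s" for i
  proof -
    consider "i = 1" | "s dvd i" | "poly.coeff P i = 0" using assms(2) by blast
    then show ?thesis
    proof cases
      case 1
      obtain k where k: "s = Suc k" using s0 gr0_conv_Suc by blast
      show ?thesis
        by (intro exI[of _ "c * poly.coeff (poly.coeff P i) s"] exI[of _ "poly.coeff (poly.coeff P i) k"] exI[of _ 0])
           (simp add: 1 k mult.commute)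
    next
      case 2
      then obtain j where j: "i = s * j" by blast
      have "[:c, t:] ^ s = [:c ^ s:] + Polynomial.monom (t ^ s) s" for t :: 'a
      proof -
        have "[:c, t:] ^ s = ([:c:] + Polynomial.monom t 1) ^ s" by (simp add: monom_altdef)
        also have "\<dots> = [:c:] ^ s + Polynomial.monom t 1 ^ s"
          unfolding s_def by (rule freshmans_dream'[where n = e]) simp_all
        finally show ?thesis by (simp add: poly_const_pow monom_power)
      qed
      then have "poly.coeff P i * [:c, t:] ^ i = poly.coeff P i * ([:c ^ s:] + Polynomial.monom (t ^ s) s) ^ j" for t :: 'a
        by (simp only: j power_mult)
      then show ?thesis using coeff_mult_power_binomial[OF s0, of "poly.coeff P i" "c ^ s" j]
        by (metis (no_types, lifting) add.right_neutral mult_zero_left)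
    next
      case 3
      then show ?thesis by (intro exI[of _ 0]) simp
    qed
  qed
  then have "\<forall>i. \<exists>u v w. \<forall>t. poly.coeff (poly.coeff P i * [:c, t:] ^ i) s = u + v * t + w * t ^ s"
    by blast
  then obtain U V W where UVW:
    "\<And>i t. poly.coeff (poly.coeff P i * [:c, t:] ^ i) s = U i + V i * t + W i * t ^ s"
    unfolding choice_iff by blast
  have "poly.coeff (poly P [:c, t:]) s = (\<Sum>i\<le>degree P. U i) + (\<Sum>i\<le>degree P. V i) * t + (\<Sum>i\<le>degree P. W i) * t ^ s" for t
    unfolding poly_altdef coeff_sum UVW by (simp add: sum.distrib sum_distrib_right)
  then show ?thesis by blast
qed

lemma prod_monom_1: "(\<Prod>x\<in>S. Polynomial.monom (g x) (Suc 0)) = Polynomial.monom (\<Prod>x\<in>S. g x) (card S)"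
  by (induction S rule: infinite_finite_induct) (simp_all add: mult_monom)

text \<open>Along the line \<open>X = c + t Y\<close> the coefficient of \<open>Y\<^sup>s\<close> in \<open>R\<close>, with \<open>s\<close> the size of the fibre
  over \<open>c\<close>, is a nonzero multiple of the product of \<open>x + t\<close> over that fibre; by sparsity it is also of
  the form \<open>u + v t + w t\<^sup>s\<close>.\<close>

lemma fibre_0_closed:
  fixes f :: "'a \<Rightarrow> 'a :: finite_field"
  assumes N: "2 * card (directions f) < CARD('a)"
    and dvd: "\<And>y. y \<in> directions f \<Longrightarrow> CHAR('a) ^ e dvd card (fibre f y 0)"
    and s: "card (fibre f 0 0) = CHAR('a) ^ e"
    and x: "f x1 = c" "f x2 = c" and l: "l ^ CHAR('a) = l"
  shows "f (x1 + l * (x2 - x1)) = c"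
proof -
  let ?s = "CHAR('a) ^ e"
  define W where "W = {x. f x = c}"
  define K where "K = (\<Prod>x\<in>- W. c - f x)"
  have K: "K \<noteq> 0" by (auto simp: K_def W_def prod_zero_iff)
  have cW: "card W = ?s"
  proof -
    have "W = fibre f 0 x1" using x by (auto simp: W_def fibre_def)
    then show ?thesis using card_fibre[OF N, of 0 x1] s by simp
  qed
  have "poly.coeff (poly (redei f) [:c, t:]) ?s = (\<Prod>x\<in>W. x + t) * K" for t
  proof -
    have "poly (redei f) [:c, t:] = (\<Prod>x\<in>UNIV. [:c - f x, x + t:])"
      by (simp add: redei_def poly_prod add.commute)
    also have "\<dots> = (\<Prod>x\<in>W. [:c - f x, x + t:]) * (\<Prod>x\<in>- W. [:c - f x, x + t:])"
      using prod.union_disjoint[of W "- W" "\<lambda>x. [:c - f x, x + t:]"] by simp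
    also have "(\<Prod>x\<in>W. [:c - f x, x + t:]) = (\<Prod>x\<in>W. Polynomial.monom (x + t) 1)"
      by (intro prod.cong) (auto simp: W_def monom_altdef)
    also have "\<dots> = Polynomial.monom (\<Prod>x\<in>W. x + t) ?s"
      using cW by (simp add: prod_monom_1)
    finally have "poly.coeff (poly (redei f) [:c, t:]) ?s
        = (\<Prod>x\<in>W. x + t) * poly.coeff (\<Prod>x\<in>- W. [:c - f x, x + t:]) 0"
      by (simp add: coeff_monom_mult)
    also have "poly.coeff (\<Prod>x\<in>- W. [:c - f x, x + t:]) 0 = K"
      by (simp add: K_def poly_prod flip: poly_0_coeff_0)
    finally show ?thesis .
  qed
  moreover obtain u v w where "\<And>t. poly.coeff (poly (redei f) [:c, t:]) ?s = u + v * t + w * t ^ ?s"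
    using coeff_poly_sparse[of e "redei f" c] coeff_redei_sparse[OF N dvd] by blast
  ultimately have uvw: "(\<Prod>x\<in>W. x + t) * K = u + v * t + w * t ^ ?s" for t by metis
  \<comment> \<open>The fibre is thus the zero set of an affine p-polynomial in
    \<open>- x\<close>.\<close>
  have iff: "f x = c \<longleftrightarrow> u + v * (- x) + w * (- x) ^ ?s = 0" for x
  proof -
    have "f x = c \<longleftrightarrow> (\<Prod>z\<in>W. z + (- x)) = 0" by (auto simp: prod_zero_iff W_def)
    also have "\<dots> \<longleftrightarrow> (\<Prod>z\<in>W. z + (- x)) * K = 0" using K by simp
    finally show ?thesis unfolding uvw .
  qed
  have frob: "(a + b) ^ ?s = a ^ ?s + b ^ ?s" for a b :: 'a
    by (rule freshmans_dream'[where n = e]) simp_all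
  \<comment> \<open>The condition on \<open>l\<close> says that it lies in the prime field, so the
    additive part v X + w X^s commutes with scaling by \<open>l\<close>.\<close>
  have ls: "l ^ ?s = l" using l by (induction e) (simp_all add: power_mult)
  let ?d = "x2 - x1"
  have "(- x2) ^ ?s = (- x1) ^ ?s + (- ?d) ^ ?s" using frob[of "- x1" "- ?d"] by simp
  then have "v * (- ?d) + w * (- ?d) ^ ?s
      = (u + v * (- x2) + w * (- x2) ^ ?s) - (u + v * (- x1) + w * (- x1) ^ ?s)"
    by (simp only:) (simp add: algebra_simps)
  also have "\<dots> = 0" using x by (simp only: iff diff_self)
  finally have d: "v * (- ?d) + w * (- ?d) ^ ?s = 0" .
  have "(- (x1 + l * ?d)) ^ ?s = (- x1 + l * (- ?d)) ^ ?s" by (simp add: algebra_simps)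
  also have "\<dots> = (- x1) ^ ?s + l * (- ?d) ^ ?s" by (simp only: frob power_mult_distrib ls)
  finally have comb: "u + v * (- (x1 + l * ?d)) + w * (- (x1 + l * ?d)) ^ ?s
      = (u + v * (- x1) + w * (- x1) ^ ?s) + l * (v * (- ?d) + w * (- ?d) ^ ?s)"
    by (simp add: algebra_simps)
  have "u + v * (- x1) + w * (- x1) ^ ?s = 0" using x by (simp only: iff)
  then show ?thesis by (simp only: iff comb d mult_zero_right add_0_right)
qed

text \<open>Subtracting \<open>x * y\<close> from \<open>f\<close> shears slope \<open>y\<close> to
  slope 0.\<close>

lemma fibre_closed:
  fixes f :: "'a \<Rightarrow> 'a :: finite_field"
  assumes N: "2 * card (directions f) < CARD('a)"
    and dvd: "\<And>y. y \<in> directions f \<Longrightarrow> CHAR('a) ^ e dvd card (fibre f y 0)"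
    and s: "card (fibre f y 0) = CHAR('a) ^ e"
    and x: "f z - f x = y * (z - x)" and l: "l ^ CHAR('a) = l"
  shows "f (x + l * (z - x)) = f x + l * (f z - f x)"
proof -
  let ?g = "\<lambda>x. f x - x * y"
  have card: "card (directions ?g) = card (directions f)"
    unfolding directions_shear by (rule card_image) (simp add: inj_on_def)
  have dvd': "CHAR('a) ^ e dvd card (fibre ?g v 0)" if "v \<in> directions ?g" for v
    using that dvd by (auto simp: directions_shear fibre_shear)
  have N': "2 * card (directions ?g) < CARD('a)" using card N by simp
  have s': "card (fibre ?g 0 0) = CHAR('a) ^ e" using s by (simp add: fibre_shear)
  have "?g z = ?g x" using x by (simp add: algebra_simps)
  from fibre_0_closed[OF N' dvd' s' refl this l]
  have "?g (x + l * (z - x)) = ?g x" .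
  then show ?thesis unfolding x by (simp add: algebra_simps)
qed


text \<open>If the slope from \<open>x\<close> to \<open>z\<close> has minimal fibre size,
  \<open>fibre_closed\<close> applies. In general the combination is built from three good slopes by
  way of an auxiliary point \<open>w\<close>.\<close>

lemma affine_combination:
  fixes f :: "'a \<Rightarrow> 'a :: finite_field"
  assumes q: "CARD('a) = CHAR('a) ^ n" and N: "2 * card (directions f) < CARD('a)"
    and p5: "5 \<le> CHAR('a)" and l: "l ^ CHAR('a) = l"
  shows "f (x + l * (z - x)) = f x + l * (f z - f x)"
proof -
  let ?p = "CHAR('a)" and ?m = "\<lambda>y. card (fibre f y 0)"
  define s where "s = Min (?m ` directions f)"
  have "s \<in> ?m ` directions f" unfolding s_def using directions_nonempty by (intro Min_in) auto
  then obtain y0 where y0: "y0 \<in> directions f" "s = ?m y0" by auto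
  have min: "s \<le> ?m y" if "y \<in> directions f" for y using that by (simp add: s_def)
  obtain e where e: "s = ?p ^ e" using card_fibre_eq_CHAR_power[OF q N] y0(2) by metis
  have dvd: "?p ^ e dvd ?m y" if y: "y \<in> directions f" for y
  proof -
    obtain k where k: "?m y = ?p ^ k" using card_fibre_eq_CHAR_power[OF q N] by metis
    have "?p ^ e \<le> ?p ^ k" using min[OF y] e k by simp
    then have "e \<le> k" using p5 by (simp add: power_increasing_iff)
    then show ?thesis using k by (simp add: le_imp_power_dvd)
  qed
  define Bd where "Bd = {y \<in> directions f. ?m y \<noteq> s}"
  have good: "f (u + k * (w - u)) = f u + k * (f w - f u)"
    if k: "k ^ ?p = k" and nb: "\<And>y. y \<in> Bd \<Longrightarrow> w \<notin> fibre f y u" for u w k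
  proof (cases "u = w")
    case False
    let ?y = "(f w - f u) / (w - u)"
    have eq: "f w - f u = ?y * (w - u)" using False by simp
    have "?y \<in> directions f" unfolding directions_def using False by blast
    moreover have "w \<in> fibre f ?y u" unfolding fibre_def mem_Collect_eq using eq by (simp only: algebra_simps)
    ultimately have "?m ?y = ?p ^ e" using nb e unfolding Bd_def by blast
    from fibre_closed[OF N dvd this eq k] show ?thesis .
  qed simp
  show ?thesis
  proof (cases "l = 0 \<or> l = 1")
    case False
    have num: "(of_nat k :: 'a) \<noteq> 0" if "0 < k" "k < 5" for k
      using that p5 by (auto simp: of_nat_eq_0_iff_char_dvd dest: dvd_imp_le)
    have "(2 :: 'a) \<noteq> - 1" using num[of 3] by (simp add: eq_neg_iff_add_eq_0)
    \<comment> \<open>The coefficient \<open>t\<close> of the last combination must avoid 0, 1 and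
      \<open>l\<close>. As 3 is nonzero, 2 and -1 differ, so one of them is not
      \<open>l\<close>.\<close>
    then obtain t :: 'a where t: "t \<in> {2, - 1}" "t \<noteq> l" by (metis insertCI)
    have "(2 :: 'a) \<noteq> 1" by (metis add_cancel_right_right one_add_one zero_neq_one)
    then have t01: "t \<noteq> 0" "1 - t \<noteq> 0" using t num[of 1] num[of 2] by auto
    have frob: "(x + y) ^ ?p = x ^ ?p + y ^ ?p" for x y :: 'a
      by (rule freshmans_dream) simp_all
    have frob_diff: "(x - y) ^ ?p = x ^ ?p - y ^ ?p" for x y :: 'a
      using frob[of "x - y" y] by (simp add: algebra_simps)
    have "(1 + 1 :: 'a) ^ ?p = 1 + 1" "(0 - 1 :: 'a) ^ ?p = 0 - 1"
      by (simp_all only: frob frob_diff) auto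
    then have tp: "t ^ ?p = t" using t(1) by auto
    \<comment> \<open>Chosen so that (1 - t) a + t b = 1: the auxiliary point cancels from the
      combination of \<open>x'\<close> and \<open>z'\<close>.\<close>
    define a b where "a = (1 - l) / (1 - t)" and "b = l / t"
    have ab: "(1 - t) * a = 1 - l" "t * b = l" using t01 by (auto simp: a_def b_def)
    have abp: "a ^ ?p = a" "b ^ ?p = b"
      by (simp_all add: a_def b_def power_divide frob_diff tp l)
    have "a \<noteq> b"
    proof
      assume "a = b"
      then have "a = 1" using ab by (simp add: algebra_simps)
      then show False using \<open>a = b\<close> ab t(2) by simp
    qed
    \<comment> \<open>The value that \<open>f w - w * y\<close> must take if the line through
      \<open>x'\<close> and \<open>z'\<close> has slope \<open>y\<close>; it is unique because
      \<open>a\<close> and \<open>b\<close> differ.\<close>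
    define c where "c y = (a * f x - b * f z - (a * x - b * z) * y) / (a - b)" for y
    define B where "B = (\<Sum>y\<in>Bd. ?m y)"
    \<comment> \<open>The points \<open>w\<close> for which one of the pairs \<open>(w, x)\<close>, \<open>(w, z)\<close>, \<open>(x', z')\<close> below has a bad direction.\<close>
    define U where "U = (\<Union>y\<in>Bd. fibre f y x) \<union> (\<Union>y\<in>Bd. fibre f y z) \<union> (\<Union>y\<in>Bd. {w. f w - w * y = c y})"
    have cfib: "card (\<Union>y\<in>Bd. F y) \<le> B" if "\<And>y. y \<in> Bd \<Longrightarrow> card (F y) \<le> ?m y" for F :: "'a \<Rightarrow> 'a set"
    proof -
      have "card (\<Union>y\<in>Bd. F y) \<le> (\<Sum>y\<in>Bd. card (F y))" by (rule card_UN_le) simp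
      also have "\<dots> \<le> B" unfolding B_def by (rule sum_mono) (rule that)
      finally show ?thesis .
    qed
    have level: "card {w. f w - w * y = c} \<le> ?m y" for y c
    proof (cases "{w. f w - w * y = c} = {}")
      case False
      then obtain w where "f w - w * y = c" by blast
      then have "{w. f w - w * y = c} = fibre f y w" by (simp add: fibre_def)
      then show ?thesis by (metis card_fibre[OF N] order_refl)
    next
      case True
      show ?thesis unfolding True by simp
    qed
    have "card (\<Union>y\<in>Bd. fibre f y v) \<le> B" for v
      by (rule cfib) (metis card_fibre[OF N] order_refl)
    moreover have "card (\<Union>y\<in>Bd. {w. f w - w * y = c y}) \<le> B"
      by (rule cfib) (rule level)
    ultimately have "card U \<le> B + B + B"
      unfolding U_def by (meson add_mono card_Un_le order.trans)
    \<comment> \<open>Three families of at most \<open>B\<close> forbidden points each cannot fill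
      the field.\<close>
    moreover have "4 * B \<le> CARD('a)"
    proof -
      have "4 * B \<le> (?p - 1) * B" using p5 by (intro mult_right_mono) auto
      also have "\<dots> \<le> CARD('a)"
        unfolding B_def Bd_def by (rule sum_card_large_fibres[OF q N y0(2,1) min])
      finally show ?thesis .
    qed
    ultimately have "card U < CARD('a)" using zero_less_card_finite[where 'a = 'a] by linarith
    then obtain w where w: "w \<notin> U" by (metis UNIV_I less_irrefl subsetI top.extremum_uniqueI)
    define x' z' where "x' = w + a * (x - w)" and "z' = w + b * (z - w)"
    have x': "f x' = f w + a * (f x - f w)"
      unfolding x'_def using w by (intro good abp) (auto simp: U_def fibre_def)
    have z': "f z' = f w + b * (f z - f w)"
      unfolding z'_def using w by (intro good abp) (auto simp: U_def fibre_def)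
    have step: "f (x' + t * (z' - x')) = f x' + t * (f z' - f x')"
    proof (intro good tp)
      fix y assume y: "y \<in> Bd"
      show "z' \<notin> fibre f y x'"
      proof
        assume "z' \<in> fibre f y x'"
        then have "f w + b * (f z - f w) - (w + b * (z - w)) * y = f w + a * (f x - f w) - (w + a * (x - w)) * y"
          by (simp add: fibre_def x' z') (simp add: x'_def z'_def)
        then have "(a - b) * (f w - w * y) = a * f x - b * f z - (a * x - b * z) * y"
          by (simp add: algebra_simps)
        then have "f w - w * y = c y" using \<open>a \<noteq> b\<close> by (simp add: c_def field_simps)
        then show False using w y by (auto simp: U_def)
      qed
    qed
    have comb: "(R + a * (P - R)) + t * ((R + b * (Q - R)) - (R + a * (P - R))) = P + l * (Q - P)" for P Q R
    proof -
      have "(R + a * (P - R)) + t * ((R + b * (Q - R)) - (R + a * (P - R)))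
        = R + ((1 - t) * a) * (P - R) + (t * b) * (Q - R)" by (simp add: algebra_simps)
      also have "\<dots> = P + l * (Q - P)" unfolding ab by (simp add: algebra_simps)
      finally show ?thesis .
    qed
    show ?thesis
      using step unfolding x' z' comb unfolding x'_def z'_def comb .
  qed auto
qed

subsection \<open>Stepanov's method\<close>

lemma order_ge_of_pderivs:
  fixes P :: "'a :: field_prime_char poly"
  assumes "k \<le> CHAR('a)" "P \<noteq> 0" "\<And>l. l < k \<Longrightarrow> poly ((pderiv ^^ l) P) t = 0"
  shows "k \<le> Polynomial.order t P"
  using assms
proof (induction k arbitrary: P)
  case (Suc k)
  define r where "r = Polynomial.order t P"
  have "poly P t = 0" using Suc.prems(3)[of 0] by simp
  then have "r \<noteq> 0" using Suc.prems(2) by (simp add: r_def order_root)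
  then obtain m where m: "r = Suc m" by (cases r) auto
  show ?case
  proof (rule ccontr)
    assume "\<not> Suc k \<le> Polynomial.order t P"
    then have less: "r < CHAR('a)" "m < k" using Suc.prems(1) m by (auto simp: r_def)
    obtain S where S: "P = [:- t, 1:] ^ r * S" "\<not> [:- t, 1:] dvd S"
      using order_decomp[OF Suc.prems(2), of t] unfolding r_def by blast
    define S' where "S' = smult (of_nat r) S + [:- t, 1:] * pderiv S"
    have "pderiv ([:- t, 1:] ^ r) = smult (of_nat r) ([:- t, 1:] ^ m)"
      unfolding m pderiv_power_Suc by (simp add: pderiv_pCons)
    then have P': "pderiv P = [:- t, 1:] ^ m * S'"
      unfolding S(1) pderiv_mult S'_def by (simp add: m algebra_simps)
    \<comment> \<open>Here k <= p enters: an order below p is nonzero in the field, so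
      differentiation lowers it by exactly one.\<close>
    have "of_nat r \<noteq> (0 :: 'a)" using less \<open>r \<noteq> 0\<close> by (auto simp: of_nat_eq_0_iff_char_dvd dest: dvd_imp_le)
    then have nz: "poly S' t \<noteq> 0" using S(2) by (simp add: S'_def poly_eq_0_iff_dvd)
    then have S'0: "S' \<noteq> 0" by auto
    then have "pderiv P \<noteq> 0" by (simp add: P')
    moreover have "poly ((pderiv ^^ l) (pderiv P)) t = 0" if "l < k" for l
      using Suc.prems(3)[of "Suc l"] that by (simp add: funpow_swap1)
    ultimately have "k \<le> Polynomial.order t (pderiv P)" using Suc.IH Suc.prems(1) by simp
    also have "\<dots> = m"
      unfolding P' using S'0 nz by (subst Polynomial.order_mult) (auto simp: order_power_n_n order_0I)
    finally show False using less by simp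
  qed
qed simp

lemma mult_card_le_degree:
  fixes P :: "'a :: field poly"
  assumes "P \<noteq> 0" "0 < k" "\<And>t. t \<in> T \<Longrightarrow> k \<le> Polynomial.order t P"
  shows "k * card T \<le> degree P"
proof -
  have sub: "T \<subseteq> {x. poly P x = 0}" using assms by (force simp: order_root)
  have fin: "finite {x. poly P x = 0}" using assms(1) by (rule poly_roots_finite)
  have "k * card T = (\<Sum>t\<in>T. k)" by simp
  also have "\<dots> \<le> (\<Sum>t\<in>T. Polynomial.order t P)" by (intro sum_mono assms(3))
  also have "\<dots> \<le> (\<Sum>x | poly P x = 0. Polynomial.order x P)" using sub fin by (intro sum_mono2) auto
  also have "\<dots> \<le> degree P" using assms(1) by (rule sum_order_le_degree)
  finally show ?thesis .
qed

text \<open>The logarithmic derivative with denominators cleared: \<open>u\<close> has a degree that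
  does not depend on the exponents \<open>e k\<close>.\<close>

lemma pderiv_prod_linear_powers:
  fixes g :: "'b \<Rightarrow> 'a :: idom"
  assumes "finite I"
  shows "\<exists>u. degree u \<le> card I - 1 \<and>
    pderiv (\<Prod>k\<in>I. [:g k, 1:] ^ e k) * (\<Prod>k\<in>I. [:g k, 1:]) = (\<Prod>k\<in>I. [:g k, 1:] ^ e k) * u"
proof -
  define L where "L k = [:g k, 1:]" for k
  have L: "pderiv (L k ^ e k) * L k = smult (of_nat (e k)) (L k ^ e k)" for k
    by (cases "e k") (simp_all only: pderiv_power_Suc L_def pderiv_pCons, simp_all add: mult_ac)
  define u where "u = (\<Sum>k\<in>I. smult (of_nat (e k)) (\<Prod>l\<in>I - {k}. L l))"
  have "degree u \<le> card I - 1"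
    unfolding u_def
  proof (rule degree_sum_le[OF assms])
    fix k assume "k \<in> I"
    have "degree (\<Prod>l\<in>I - {k}. L l) = card I - 1"
      unfolding L_def using degree_prod_monic_linear(1)[of "I - {k}" g] assms \<open>k \<in> I\<close> by simp
    then show "degree (smult (of_nat (e k)) (\<Prod>l\<in>I - {k}. L l)) \<le> card I - 1"
      by (metis degree_smult_le)
  qed
  moreover have "pderiv (\<Prod>k\<in>I. L k ^ e k) * (\<Prod>k\<in>I. L k) = (\<Prod>k\<in>I. L k ^ e k) * u"
    unfolding pderiv_prod u_def sum_distrib_left sum_distrib_right
  proof (rule sum.cong[OF refl])
    fix k assume k: "k \<in> I"
    have "(\<Prod>l\<in>I - {k}. L l ^ e l) * pderiv (L k ^ e k) * (\<Prod>k\<in>I. L k)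
      = (\<Prod>l\<in>I - {k}. L l ^ e l) * (pderiv (L k ^ e k) * L k) * (\<Prod>l\<in>I - {k}. L l)"
      using prod.remove[OF assms k, of L] by (simp add: mult_ac)
    also have "\<dots> = (\<Prod>k\<in>I. L k ^ e k) * smult (of_nat (e k)) (\<Prod>l\<in>I - {k}. L l)"
      unfolding L using prod.remove[OF assms k, of "\<lambda>k. L k ^ e k"] by (simp add: mult_ac)
    finally show "(\<Prod>l\<in>I - {k}. L l ^ e l) * pderiv (L k ^ e k) * (\<Prod>k\<in>I. L k)
      = (\<Prod>k\<in>I. L k ^ e k) * smult (of_nat (e k)) (\<Prod>l\<in>I - {k}. L l)" .
  qed
  ultimately show ?thesis unfolding L_def by blast
qed

text \<open>If \<open>T' W = T u\<close>, then \<open>scaled_deriv W u l F\<close> is \<open>W\<^sup>l / T\<close> times the \<open>l\<close>-th derivative of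
  \<open>F T\<close>. Each step raises the degree by at most \<open>degree W - 1\<close>, independently of the degree of \<open>T\<close>.\<close>

fun scaled_deriv :: "'a :: idom poly \<Rightarrow> 'a poly \<Rightarrow> nat \<Rightarrow> 'a poly \<Rightarrow> 'a poly" where
  "scaled_deriv W u 0 F = F"
| "scaled_deriv W u (Suc l) F = u * scaled_deriv W u l F + W * pderiv (scaled_deriv W u l F) - smult (of_nat l) (pderiv W * scaled_deriv W u l F)"

lemma scaled_deriv_diff: "scaled_deriv W u l (F - G) = scaled_deriv W u l F - scaled_deriv W u l G"
proof (induction l)
  case (Suc l)
  show ?case
    by (simp only: scaled_deriv.simps Suc pderiv_diff right_diff_distrib smult_diff_right) (simp add: algebra_simps)
qed simp

lemma degree_scaled_deriv:
  assumes "degree F \<le> m" "degree W \<le> Suc w" "degree u \<le> w"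
  shows "degree (scaled_deriv W u l F) \<le> m + l * w"
proof (induction l)
  case (Suc l)
  let ?G = "scaled_deriv W u l F" and ?b = "m + Suc l * w"
  have "degree (pderiv Q * R) \<le> w + (m + l * w)" if "degree Q + degree R \<le> Suc (w + (m + l * w))" for Q R :: "'a poly"
  proof (cases "degree Q = 0")
    case True
    then obtain a where "Q = [:a:]" by (metis degree_eq_zeroE)
    then show ?thesis by simp
  next
    case False
    then show ?thesis using that degree_pderiv_le[of Q] degree_mult_le[of "pderiv Q" R] by simp
  qed
  note d = this
  have 1: "degree (u * ?G) \<le> ?b" using degree_mult_le[of u ?G] assms Suc by simp
  have 2: "degree (W * pderiv ?G) \<le> ?b" using d[of ?G W] assms Suc by (simp add: mult.commute)
  have "degree (pderiv W * ?G) \<le> ?b" using d[of W ?G] assms Suc by simp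
  then have 3: "degree (smult (of_nat l) (pderiv W * ?G)) \<le> ?b" by (rule order.trans[OF degree_smult_le])
  show ?case unfolding scaled_deriv.simps by (intro degree_diff_le degree_add_le 1 2 3)
qed (use assms in simp)

lemma higher_pderiv_eq_scaled_deriv:
  assumes "pderiv T * W = T * u"
  shows "W ^ l * (pderiv ^^ l) (F * T) = T * scaled_deriv W u l F"
proof (induction l)
  case (Suc l)
  let ?H = "(pderiv ^^ l) (F * T)" and ?G = "scaled_deriv W u l F"
  have pW: "W * pderiv (W ^ l) = smult (of_nat l) (W ^ l * pderiv W)"
    by (cases l) (simp_all only: pderiv_power_Suc, simp_all add: mult_ac)
  have "W ^ Suc l * pderiv ?H = W * pderiv (W ^ l * ?H) - W * pderiv (W ^ l) * ?H"
    by (simp add: pderiv_mult algebra_simps)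
  also have "W * pderiv (W ^ l) * ?H = smult (of_nat l) (pderiv W * (W ^ l * ?H))"
    unfolding pW by (simp add: mult_ac)
  also have "W * pderiv (W ^ l * ?H) = (pderiv T * W) * ?G + T * (W * pderiv ?G)"
    unfolding Suc by (simp add: pderiv_mult algebra_simps)
  finally show ?case unfolding assms Suc by (simp add: algebra_simps)
qed simp

text \<open>The terms have pairwise distinct orders \<open>\<epsilon> s\<close> at
  \<open>- g\<close>, so the nonzero term of least order cannot be cancelled.\<close>

lemma linear_powers_independent:
  fixes g :: "'a :: field"
  assumes "finite S" "(\<Sum>s\<in>S. smult (c s) ([:g, 1:] ^ \<epsilon> s * U s)) = 0"
    and U: "\<And>s. s \<in> S \<Longrightarrow> poly (U s) (- g) \<noteq> 0" and inj: "inj_on \<epsilon> S"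
  shows "\<forall>s\<in>S. c s = 0"
proof (rule ccontr)
  assume "\<not> (\<forall>s\<in>S. c s = 0)"
  then obtain s0 where s0: "s0 \<in> S" "c s0 \<noteq> 0" and min: "\<And>s. s \<in> S \<Longrightarrow> c s \<noteq> 0 \<Longrightarrow> \<epsilon> s0 \<le> \<epsilon> s"
    using ex_has_least_nat[of "\<lambda>s. s \<in> S \<and> c s \<noteq> 0" _ \<epsilon>] by (metis (no_types, lifting))
  let ?t = "\<lambda>s. smult (c s) ([:g, 1:] ^ \<epsilon> s * U s)"
  have "[:g, 1:] ^ Suc (\<epsilon> s0) dvd ?t s" if "s \<in> S - {s0}" for s
  proof (cases "c s = 0")
    case False
    then have "\<epsilon> s0 < \<epsilon> s" using that min[of s] inj s0 by (metis DiffE inj_onD insertI1 le_neq_implies_less)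
    then show ?thesis by (intro dvd_smult dvd_mult2 le_imp_power_dvd) simp
  qed simp
  then have "[:g, 1:] ^ Suc (\<epsilon> s0) dvd (\<Sum>s\<in>S - {s0}. ?t s)" by (rule dvd_sum)
  moreover have "?t s0 = - (\<Sum>s\<in>S - {s0}. ?t s)"
    using assms(2) sum.remove[OF assms(1) s0(1), of ?t] by (simp add: eq_neg_iff_add_eq_0)
  ultimately have "[:g, 1:] ^ Suc (\<epsilon> s0) dvd ?t s0" by simp
  then have "[:g, 1:] ^ \<epsilon> s0 * [:g, 1:] dvd [:g, 1:] ^ \<epsilon> s0 * U s0"
    using s0(2) by (simp only: dvd_smult_iff power_Suc2 simp_thms)
  then have "[:g, 1:] dvd U s0" by (subst (asm) dvd_times_left_cancel_iff) auto
  then have "poly (U s0) (- g) = 0" by (auto elim!: dvdE)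
  then show False using U s0(1) by blast
qed

section \<open>Base-p digits of the multiples of N = (p^n - 1) / d\<close>

lemma digit_congruence:
  fixes p d n N i k :: nat
  assumes dN: "d * N = p ^ n - 1" and i: "i < d" and k: "k < n" and p: "0 < p"
  defines "c \<equiv> (d * (i * N mod p ^ k) + i) div p ^ k"
  shows "c < d" "p dvd d * ((i * N div p ^ k) mod p) + c"
proof -
  \<comment> \<open>The number \<open>c\<close> is the carry into position \<open>k\<close> when d
    (i N) + i = i p^n is computed in base p; the digit of i p^n there is 0 because k < n.\<close>
  define u v where "u = i * N div p ^ k" and "v = i * N mod p ^ k"
  have uv: "i * N = u * p ^ k + v" "v < p ^ k"
    using p by (simp_all only: u_def v_def div_mult_mod_eq mod_less_divisor zero_less_power)
  have "d * (i * N) + i = i * p ^ n"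
  proof -
    have "d * (i * N) + i = i * (d * N + 1)" by (simp add: algebra_simps)
    then show ?thesis using p by (simp add: dN)
  qed
  moreover have "p ^ n = p ^ (n - k) * p ^ k" using k by (simp flip: power_add)
  ultimately have eq: "d * u * p ^ k + (d * v + i) = i * p ^ (n - k) * p ^ k"
    unfolding uv(1) by (simp add: algebra_simps)
  then have "p ^ k dvd d * v + i" by (metis dvd_add_right_iff dvd_triv_right)
  then have c: "d * v + i = c * p ^ k" unfolding c_def v_def by (metis dvd_div_mult_self)
  have "d * v + i < d * (v + 1)" using i by simp
  also have "\<dots> \<le> d * p ^ k" using uv(2) by (intro mult_le_mono2) simp
  finally show "c < d" unfolding c using p by simp
  have "(d * u + c) * p ^ k = i * p ^ (n - k) * p ^ k" using eq c by (simp add: algebra_simps)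
  then have "d * u + c = i * p ^ (n - k)" using p by simp
  then have "p dvd d * u + c" using k by simp
  moreover have "d * u + c = p * (d * (u div p)) + (d * (u mod p) + c)"
    by (metis add.assoc add_mult_distrib2 mult.left_commute mult_div_mod_eq)
  ultimately show "p dvd d * ((i * N div p ^ k) mod p) + c"
    unfolding u_def by (metis dvd_add_right_iff dvd_triv_left)
qed

text \<open>The congruence reads d e + c = p r with r < d, so d e <= p (d - 1): every digit stays
  about p / d below p.\<close>

lemma digit_bound:
  fixes p d n N i k A :: nat
  assumes dN: "d * N = p ^ n - 1" and i: "i < d" and k: "k < n" and A: "A * d \<le> p" and p: "0 < p"
  shows "(i * N div p ^ k) mod p + A \<le> p"
proof -
  define e where "e = (i * N div p ^ k) mod p"
  obtain c r where c: "c < d" and r: "d * e + c = p * r"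
    using digit_congruence[OF dN i k p] unfolding e_def by (metis dvdE)
  have "e < p" using p by (simp add: e_def)
  have "p * r < d * (e + 1)" using c r by simp
  also have "\<dots> \<le> d * p" using \<open>e < p\<close> by (intro mult_le_mono2) simp
  finally have "r < d" by simp
  have "d * e \<le> p * r" using r by simp
  also have "\<dots> \<le> p * (d - 1)" using \<open>r < d\<close> by (intro mult_le_mono2) simp
  also have "\<dots> = p * d - p" by (simp add: diff_mult_distrib2)
  finally have "d * e + d * A \<le> p * d - p + p" using A by (simp add: mult.commute)
  also have "\<dots> = d * p" using i by (simp add: mult.commute)
  finally have "d * (e + A) \<le> d * p" by (simp add: algebra_simps)
  then show ?thesis using i by (simp add: e_def)
qed

text \<open>At position 0 the carry is \<open>i\<close> itself, so d e + i = p r. Reduction mod d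
  shows that distinct \<open>i\<close> have distinct \<open>r\<close>, and a step in
  \<open>r\<close> moves the digit by about p / d.\<close>

lemma digit_0_spaced:
  fixes p d n N i i' A :: nat
  assumes dN: "d * N = p ^ n - 1" and i: "i < d" "i' < d" "i \<noteq> i'" and n: "0 < n"
    and A: "A * d \<le> p" and p: "0 < p"
  shows "(i * N) mod p + A \<le> (i' * N) mod p \<or> (i' * N) mod p + A \<le> (i * N) mod p"
proof -
  have key: "e + A \<le> e'" if "d * e + i = p * r" "d * e' + i' = p * r'" "r < r'" "i < d" "i' < d" for e e' r r' i i' :: nat
  proof -
    have "p * (r + 1) \<le> p * r'" using that by (intro mult_le_mono2) simp
    then have "d * e + i + p \<le> d * e' + i'" using that by simp
    then have "d * (e + A) < d * (e' + 1)" using A that by (simp add: algebra_simps)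
    then have "e + A < e' + 1" by (simp only: Nat.mult_less_cancel1)
    then show ?thesis by simp
  qed
  obtain r r' where r: "d * ((i * N) mod p) + i = p * r" "d * ((i' * N) mod p) + i' = p * r'"
    using digit_congruence(2)[OF dN i(1) n p] digit_congruence(2)[OF dN i(2) n p] by (auto elim!: dvdE)
  have "r \<noteq> r'"
  proof
    assume "r = r'"
    then have "(d * ((i * N) mod p) + i) mod d = (d * ((i' * N) mod p) + i') mod d" using r by simp
    then show False using i by simp
  qed
  then show ?thesis using key[OF r] key[OF r(2,1)] i by linarith
qed

lemma sum_digits:
  fixes p m n :: nat
  assumes "m < p ^ n"
  shows "(\<Sum>k<n. (m div p ^ k) mod p * p ^ k) = m"
  using assms
proof (induction n arbitrary: m)
  case (Suc n)
  have "(\<Sum>k<Suc n. (m div p ^ k) mod p * p ^ k) = m mod p + (\<Sum>k<n. (m div p ^ Suc k) mod p * p ^ Suc k)"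
    by (subst sum.lessThan_Suc_shift) simp
  also have "(\<Sum>k<n. (m div p ^ Suc k) mod p * p ^ Suc k) = p * (\<Sum>k<n. ((m div p) div p ^ k) mod p * p ^ k)"
    by (simp add: sum_distrib_left div_mult2_eq mult_ac)
  also have "\<dots> = p * (m div p)"
    using Suc.prems by (subst Suc.IH) (simp_all add: less_mult_imp_div_less mult.commute)
  finally show ?case by simp
qed simp

text \<open>Pigeonhole in place of linear algebra: there are more vectors than patterns of
  coefficients, and the difference of two colliding vectors is the solution.\<close>

lemma exists_kernel_element:
  fixes \<Phi> :: "('k \<Rightarrow> 'a :: finite_field) \<Rightarrow> 'e \<Rightarrow> 'a poly"
  assumes fin: "finite K" "finite E" and less: "(\<Sum>e\<in>E. b e) < card K"
    and diff: "\<And>c c' e. \<Phi> (\<lambda>k. c k - c' k) e = \<Phi> c e - \<Phi> c' e"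
    and deg: "\<And>c e. e \<in> E \<Longrightarrow> degree (\<Phi> c e) < b e"
  obtains c k where "k \<in> K" "c k \<noteq> 0" "\<And>e. e \<in> E \<Longrightarrow> \<Phi> c e = 0"
proof -
  define D where "D = PiE K (\<lambda>_. UNIV :: 'a set)"
  define I where "I = Sigma E (\<lambda>e. {..<b e})"
  define g where "g c = restrict (\<lambda>(e, r). poly.coeff (\<Phi> c e) r) I" for c
  have "finite I" using fin by (simp add: I_def)
  have "1 < CARD('a)" using card_mono[of UNIV "{0,1::'a}"] by simp
  moreover have "card I < card K" using fin less by (simp add: I_def)
  ultimately have "card (PiE I (\<lambda>_. UNIV :: 'a set)) < card D"
    using fin \<open>finite I\<close> by (simp add: D_def card_funcsetE)
  moreover have "g ` D \<subseteq> PiE I (\<lambda>_. UNIV)" by (auto simp: g_def)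
  moreover have "finite (PiE I (\<lambda>_. UNIV :: 'a set))" using \<open>finite I\<close> by (intro finite_PiE) auto
  ultimately have "\<not> inj_on g D" by (metis card_inj_on_le leD)
  then obtain c c' where c: "c \<in> D" "c' \<in> D" "c \<noteq> c'" "g c = g c'" by (auto simp: inj_on_def)
  then obtain k where k: "k \<in> K" "c k \<noteq> c' k" unfolding D_def by (metis PiE_ext)
  have "\<Phi> (\<lambda>k. c k - c' k) e = 0" if e: "e \<in> E" for e
  proof -
    have "poly.coeff (\<Phi> c e) r = poly.coeff (\<Phi> c' e) r" for r
    proof (cases "r < b e")
      case True
      then have "(e, r) \<in> I" using e by (simp add: I_def)
      then show ?thesis using fun_cong[OF c(4), of "(e, r)"] by (simp add: g_def)
    next
      case False
      then have "degree (\<Phi> c e) < r" "degree (\<Phi> c' e) < r" using deg[OF e] by (meson not_less order.strict_trans2)+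
      then show ?thesis by (simp add: coeff_eq_0)
    qed
    then show ?thesis unfolding diff by (simp add: poly_eq_iff)
  qed
  with k that[of k "\<lambda>k. c k - c' k"] show thesis by simp
qed

lemma prod_lessThan_add: "(\<Prod>k<n + (m :: nat). h k) = (\<Prod>k<n. h k) * (\<Prod>k<m. h (n + k) :: 'a :: comm_monoid_mult)"
  by (induction m) (simp_all add: mult_ac)

lemma sum_lessThan_add: "(\<Sum>k<n + (m :: nat). h k) = (\<Sum>k<n. h k) + (\<Sum>k<m. h (n + k) :: 'a :: comm_monoid_add)"
  by (induction m) (simp_all add: ac_simps)

lemma of_nat_power_CHAR: "(of_nat k :: 'a :: field_prime_char) ^ CHAR('a) = of_nat k"
proof (induction k)
  case (Suc k)
  have "(of_nat k + 1 :: 'a) ^ CHAR('a) = of_nat k ^ CHAR('a) + 1 ^ CHAR('a)"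
    by (rule freshmans_dream) simp_all
  then show ?case using Suc by (simp add: add.commute)
qed (simp add: power_0_left)

lemma add_power_CHAR_power:
  fixes t \<gamma> :: "'a :: field_prime_char"
  assumes "t ^ CHAR('a) = t"
  shows "(\<gamma> + t) ^ (CHAR('a) ^ k) = \<gamma> ^ (CHAR('a) ^ k) + t"
proof -
  have "t ^ (CHAR('a) ^ k) = t" using assms by (induction k) (simp_all add: power_mult)
  moreover have "(\<gamma> + t) ^ (CHAR('a) ^ k) = \<gamma> ^ (CHAR('a) ^ k) + t ^ (CHAR('a) ^ k)"
    by (rule freshmans_dream'[where n = k]) simp_all
  ultimately show ?thesis by simp
qed

lemma higher_pderiv_mult_const:
  assumes "pderiv G = 0"
  shows "(pderiv ^^ l) (G * H) = G * (pderiv ^^ l) H"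
  by (induction l) (simp_all add: pderiv_mult assms)

lemma sum_arith: "2 * (\<Sum>l<L. C + l * w) + w * L = 2 * L * C + w * L * (L :: nat)"
  by (induction L) (simp_all add: algebra_simps)

text \<open>The value of \<open>A\<close> is tailored to this: twice the sum equals 12 r A - 20 r,
  and \<open>m\<close> is at most d / 2.\<close>

lemma stepanov_count:
  fixes r m d :: nat
  defines "A \<equiv> 2 * (2 * r + 1)\<^sup>2"
  assumes "0 < r" "2 * m \<le> d" "0 < d"
  shows "m * (\<Sum>l<4 * r. (A + 3 * r - 1) + l * (2 * r + 1)) < d * (3 * r * A)"
proof -
  let ?S = "\<Sum>l<4 * r. (A + 3 * r - 1) + l * (2 * r + 1)"
  obtain k where k: "r = Suc k" using assms(2) gr0_conv_Suc by blast
  have "2 * ?S + (2 * r + 1) * (4 * r) = 2 * (4 * r) * (A + 3 * r - 1) + (2 * r + 1) * (4 * r) * (4 * r)"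
    by (rule sum_arith)
  then have "2 * ?S < 4 * (3 * r * A)"
    by (simp add: k A_def power2_eq_square algebra_simps)
  then have S: "?S < 2 * (3 * r * A)" by linarith
  have "2 * (m * ?S) \<le> d * ?S" using mult_le_mono1[OF assms(3), of ?S] by (simp only: mult.assoc)
  also have "\<dots> < d * (2 * (3 * r * A))" using S assms(4) by (simp only: Nat.mult_less_cancel1)
  finally show ?thesis by linarith
qed

text \<open>The products \<open>T i\<close> take at a prime-field point \<open>t\<close> the value
  \<open>g ^ i\<close> times a common factor, with \<open>g\<close> in \<open>M\<close>. Few values
  \<open>g\<close> mean few linear conditions for a combination \<open>\<Psi>\<close> to vanish to
  order \<open>L\<close> at all p points. Without conjugacy \<open>\<Psi>\<close> is nonzero and has
  more zeros than its degree permits.\<close>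

lemma coset_values_imp_conjugate:
  fixes \<alpha> \<beta> :: "'a :: finite_field" and M :: "'a set"
  assumes q: "CARD('a) = CHAR('a) ^ n" and n: "2 \<le> n" and d: "0 < d"
    and p: "2 * (2 * n - 1)\<^sup>2 * d \<le> CHAR('a)"
    and dN: "d * N = CARD('a) - 1" and cM: "2 * card M \<le> d"
    and M: "\<And>t. t ^ CHAR('a) = t \<Longrightarrow> ((\<alpha> + t) / (\<beta> + t)) ^ N \<in> M"
    and nz: "\<And>t. t ^ CHAR('a) = t \<Longrightarrow> \<alpha> + t \<noteq> 0" "\<And>t. t ^ CHAR('a) = t \<Longrightarrow> \<beta> + t \<noteq> 0"
    and inj: "inj_on (\<lambda>k. \<beta> ^ (CHAR('a) ^ k)) {..<n}"
  shows "\<exists>k<n. \<alpha> = \<beta> ^ (CHAR('a) ^ k)"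
proof (rule ccontr)
  assume nconj: "\<not> (\<exists>k<n. \<alpha> = \<beta> ^ (CHAR('a) ^ k))"
  let ?p = "CHAR('a)"
  have p0: "0 < ?p" by simp
  obtain r where r: "n = Suc r" "0 < r" using n by (cases n) auto
  \<comment> \<open>\<open>A\<close> is the guaranteed spacing of the exponents \<open>dig i 0\<close>. A degree count forces
    \<open>L = J + r\<close>, and \<open>J = 3 r\<close> makes the count of unknowns against equations succeed.\<close>
  define A where "A = 2 * (2 * r + 1)\<^sup>2"
  define J where "J = 3 * r"
  define L where "L = 4 * r"
  define E where "E = ?p - A"
  define B where "B = [:\<beta>, 1:]"
  have A0: "0 < A" by (simp add: A_def)
  have Ad: "A * d \<le> ?p" using p r by (simp add: A_def)
  have Ap: "A \<le> ?p" using Ad d mult_le_mono2[of 1 d A] by linarith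
  have EA: "E + A = ?p" using Ap by (simp add: E_def)
  have dN': "d * N = ?p ^ n - 1" using dN q by simp
  define dig where "dig i k = (i * N div ?p ^ k) mod ?p" for i k
  have dig: "dig i k \<le> E" if "i < d" "k < n" for i k
    using digit_bound[OF dN' that Ad p0] by (simp add: dig_def E_def)
  have spaced: "dig i 0 + A \<le> dig i' 0 \<or> dig i' 0 + A \<le> dig i 0" if "i < d" "i' < d" "i \<noteq> i'" for i i'
    using digit_0_spaced[OF dN' that _ Ad p0] n by (simp add: dig_def)
  have digsum: "(\<Sum>k<n. ?p ^ k * dig i k) = i * N" if "i < d" for i
  proof -
    have "i * N \<le> d * N" using that by simp
    also have "\<dots> < ?p ^ n" using dN' p0 by (simp add: less_eq_Suc_le)
    finally show ?thesis using sum_digits[of "i * N" ?p n] by (simp add: dig_def mult.commute)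
  qed
  \<comment> \<open>The first \<open>n\<close> indices carry conjugates of \<open>\<alpha>\<close>,
    the next \<open>n\<close> those of \<open>\<beta>\<close>. Exponents \<open>E - dig\<close>
    instead of \<open>- dig\<close> clear the denominators by a factor independent of
    \<open>i\<close>.\<close>
  define \<gamma> where "\<gamma> k = (if k < n then \<alpha> ^ (?p ^ k) else \<beta> ^ (?p ^ (k - n)))" for k
  define ex where "ex i k = (if k < n then dig i k else E - dig i (k - n))" for i k
  define T where "T i = (\<Prod>k<n + n. [:\<gamma> k, 1:] ^ ex i k)" for i
  define W where "W = (\<Prod>k<n + n. [:\<gamma> k, 1:])"
  have "\<forall>i. \<exists>u. degree u \<le> n + n - 1 \<and> pderiv (T i) * W = T i * u"
    using pderiv_prod_linear_powers[of "{..<n + n}" \<gamma>] unfolding T_def W_def by simp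
  then obtain u where u': "\<forall>i. degree (u i) \<le> n + n - 1 \<and> pderiv (T i) * W = T i * u i"
    unfolding choice_iff by blast
  have u: "degree (u i) \<le> 2 * r + 1" "pderiv (T i) * W = T i * u i" for i
    using spec[OF u', of i] r(1) by simp_all
  have degW: "degree W \<le> Suc (2 * r + 1)"
    unfolding W_def using degree_prod_monic_linear(1)[of "{..<n + n}" \<gamma>] r by simp

  \<comment> \<open>On the prime field \<open>B ^ (p j)\<close> agrees with \<open>(X + \<beta>\<^sup>p) ^ j\<close>, which has low degree and replaces it in
    the vanishing conditions \<open>\<Phi> c (\<mu>, l) = 0\<close>; here \<open>\<mu>\<close> stands for the value of the \<open>N\<close>-th power of the quotient.
    Expanding everything in powers of \<open>B\<close> makes the orders of the terms of \<open>\<Psi>\<close> at \<open>- \<beta>\<close> distinct.\<close>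
  define F where "F c i j = (\<Sum>a<A. smult (c (i, j, a)) (B ^ a))" for c :: "nat \<times> nat \<times> nat \<Rightarrow> 'a" and i j
  define \<Phi> where "\<Phi> c e = (\<Sum>i<d. \<Sum>j<J. smult (fst e ^ i) ([:\<beta> ^ ?p, 1:] ^ j * scaled_deriv W (u i) (snd e) (F c i j)))"
    for c and e :: "'a \<times> nat"
  define K where "K = {..<d} \<times> {..<J} \<times> {..<A}"
  have degF: "degree (F c i j) \<le> A - 1" for c i j
    unfolding F_def B_def
    by (intro degree_sum_le order.trans[OF degree_smult_le]) (auto simp: degree_linear_power)
  have Fdiff: "F (\<lambda>k. c k - c' k) i j = F c i j - F c' i j" for c c' i j
    by (simp add: F_def smult_diff_left sum_subtractf)
  obtain c k0 where k0: "k0 \<in> K" "c k0 \<noteq> 0" and c: "\<And>e. e \<in> M \<times> {..<L} \<Longrightarrow> \<Phi> c e = 0"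
  proof (rule exists_kernel_element[of K "M \<times> {..<L}" "\<lambda>e. (A + 3 * r - 1) + snd e * (2 * r + 1)" \<Phi>])
    have "(\<Sum>e\<in>M \<times> {..<L}. (A + 3 * r - 1) + snd e * (2 * r + 1))
      = card M * (\<Sum>l<L. (A + 3 * r - 1) + l * (2 * r + 1))"
      by (simp add: sum.cartesian_product' del: sum_constant_scale)
    also have "\<dots> < d * (3 * r * A)"
      unfolding A_def L_def using stepanov_count[OF r(2) cM d] .
    finally show "(\<Sum>e\<in>M \<times> {..<L}. (A + 3 * r - 1) + snd e * (2 * r + 1)) < card K"
      by (simp add: K_def J_def mult_ac)
    show "\<Phi> (\<lambda>k. c k - c' k) e = \<Phi> c e - \<Phi> c' e" for c c' e
      by (simp add: \<Phi>_def Fdiff scaled_deriv_diff right_diff_distrib smult_diff_right sum_subtractf)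
    show "degree (\<Phi> c e) < A + 3 * r - 1 + snd e * (2 * r + 1)" for c e
    proof -
      have "degree (\<Phi> c e) \<le> (J - 1) + (A - 1 + snd e * (2 * r + 1))"
        unfolding \<Phi>_def
      proof (intro degree_sum_le order.trans[OF degree_smult_le] order.trans[OF degree_mult_le] add_mono)
        fix i j assume "j \<in> {..<J}"
        then show "degree ([:\<beta> ^ ?p, 1:] ^ j) \<le> J - 1" by (auto simp: degree_linear_power)
        show "degree (scaled_deriv W (u i) (snd e) (F c i j)) \<le> A - 1 + snd e * (2 * r + 1)"
          by (rule degree_scaled_deriv[OF degF degW u(1)])
      qed simp_all
      then show ?thesis using A0 r(2) by (simp add: J_def)
    qed
  qed (auto simp: K_def)

  define \<Psi> where "\<Psi> = (\<Sum>i<d. \<Sum>j<J. B ^ (?p * j) * (F c i j * T i))"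
  \<comment> \<open>Index \<open>n\<close> is the one with \<open>\<gamma> n = \<beta>\<close>;
    splitting it off leaves a cofactor that will be nonzero at \<open>- \<beta>\<close>.\<close>
  define U where "U i = (\<Prod>k\<in>{..<n + n} - {n}. [:\<gamma> k, 1:] ^ ex i k)" for i
  have T_U: "T i = B ^ (E - dig i 0) * U i" for i
    unfolding T_def U_def using n by (subst prod.remove[of _ n]) (auto simp: \<gamma>_def ex_def B_def)
  define \<epsilon> where "\<epsilon> = (\<lambda>(i, j, a). ?p * j + (a + (E - dig i 0)))"
  have \<Psi>_sum: "\<Psi> = (\<Sum>(i, j, a)\<in>K. smult (c (i, j, a)) (B ^ \<epsilon> (i, j, a) * U i))"
  proof -
    have "\<Psi> = (\<Sum>i<d. \<Sum>j<J. \<Sum>a<A. smult (c (i, j, a)) (B ^ \<epsilon> (i, j, a) * U i))"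
      unfolding \<Psi>_def F_def T_U sum_distrib_left sum_distrib_right \<epsilon>_def
      by (simp add: power_add mult_ac)
    then show ?thesis by (simp add: K_def sum.cartesian_product')
  qed

  have "\<Psi> \<noteq> 0"
  proof
    assume "\<Psi> = 0"
    then have eq: "(\<Sum>s\<in>K. smult (c s) ([:\<beta>, 1:] ^ \<epsilon> s * U (fst s))) = 0"
      unfolding \<Psi>_sum B_def by (simp add: case_prod_unfold)
    have conj: "\<alpha> ^ (?p ^ k) \<noteq> \<beta>" if "k < n" for k
    proof
      assume eq: "\<alpha> ^ (?p ^ k) = \<beta>"
      have "\<beta> ^ (?p ^ (n - k)) = \<alpha> ^ (?p ^ n)"
        using that by (simp flip: eq power_mult power_add)
      then have "\<beta> ^ (?p ^ (n - k)) = \<alpha>" using q finite_field_power_card_eq_same[of \<alpha>] by simp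
      moreover have "\<alpha> = \<beta> ^ (?p ^ 0)" if "k = 0" using eq that by simp
      ultimately show False using nconj that n
        by (cases "k = 0") (metis diff_less not_gr_zero order.strict_trans1 zero_less_numeral less_le_trans, metis diff_less less_imp_le_nat not_gr_zero order.strict_trans1 zero_less_diff that)
    qed
    have "poly (U i) (- \<beta>) \<noteq> 0" for i
    proof -
      have "\<gamma> k \<noteq> \<beta>" if "k < n + n" "k \<noteq> n" for k
      proof (cases "k < n")
        case False
        then have "k - n \<noteq> 0" "k - n < n" using that by auto
        then have "\<beta> ^ (?p ^ (k - n)) \<noteq> \<beta> ^ (?p ^ 0)" using inj_onD[OF inj, of "k - n" 0] n by auto
        then show ?thesis using False by (simp add: \<gamma>_def)
      qed (use conj in \<open>simp add: \<gamma>_def\<close>)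
      then show ?thesis by (auto simp: U_def poly_prod prod_zero_iff)
    qed
    moreover have "inj_on \<epsilon> K"
    proof (rule inj_onI)
      fix s s' assume s: "s \<in> K" "s' \<in> K" "\<epsilon> s = \<epsilon> s'"
      obtain i j a i' j' a' where ss: "s = (i, j, a)" "s' = (i', j', a')" by (metis prod_cases3)
      have lt: "i < d" "i' < d" "a < A" "a' < A" using s ss by (auto simp: K_def)
      \<comment> \<open>As a < A and E + A = p, this summand is the residue of the exponent mod p.
        The spacing of the digits then separates \<open>i\<close>, and hence
        \<open>a\<close>.\<close>
      have "a + (E - dig i 0) < ?p" "a' + (E - dig i' 0) < ?p" using lt EA by linarith+
      moreover have eq: "?p * j + (a + (E - dig i 0)) = ?p * j' + (a' + (E - dig i' 0))"
        using s(3) by (simp add: ss \<epsilon>_def)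
      ultimately have "a + (E - dig i 0) = a' + (E - dig i' 0)"
        by (metis mod_less mod_mult_self4)
      moreover have "j = j'" using eq calculation p0 by simp
      moreover have "dig i 0 \<le> E" "dig i' 0 \<le> E" using dig lt n by auto
      moreover have "i = i'"
        using spaced[OF lt(1,2)] calculation lt(3,4) by linarith
      ultimately show "s = s'" by (simp add: ss)
    qed
    ultimately have "\<forall>s\<in>K. c s = 0"
      by (intro linear_powers_independent[OF _ eq]) (auto simp: K_def)
    then show False using k0 by blast
  qed

  have "degree \<Psi> \<le> ?p * (J - 1) + (A - 1 + n * E)"
    unfolding \<Psi>_def
  proof (intro degree_sum_le order.trans[OF degree_mult_le] add_mono degF)
    fix i j assume ij: "i \<in> {..<d}" "j \<in> {..<J}"
    then have "?p * j \<le> ?p * (J - 1)" by (intro mult_le_mono2) auto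
    then show "degree (B ^ (?p * j)) \<le> ?p * (J - 1)" by (simp add: B_def degree_linear_power)
    have "degree (T i) \<le> (\<Sum>k<n + n. ex i k)"
      unfolding T_def using degree_prod_sum_le[of "{..<n + n}" "\<lambda>k. [:\<gamma> k, 1:] ^ ex i k"]
      by (simp add: o_def degree_linear_power)
    also have "\<dots> = (\<Sum>k<n. dig i k) + (\<Sum>k<n. E - dig i k)"
      by (simp add: sum_lessThan_add ex_def)
    also have "\<dots> = (\<Sum>k<n. E)"
      using dig ij by (simp flip: sum.distrib)
    finally show "degree (T i) \<le> n * E" by simp
  qed simp_all
  moreover have "L * card (of_nat ` {..<?p} :: 'a set) \<le> degree \<Psi>"
  proof (rule mult_card_le_degree[OF \<open>\<Psi> \<noteq> 0\<close>])
    show "0 < L" using r by (simp add: L_def)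
    have "4 * r \<le> A" by (simp add: A_def power2_eq_square)
    then have Lp: "L \<le> ?p" using Ap by (simp add: L_def)
    fix t :: 'a assume "t \<in> of_nat ` {..<?p}"
    then have t: "t ^ ?p = t" using of_nat_power_CHAR by auto
    define g where "g = ((\<alpha> + t) / (\<beta> + t)) ^ N"
    define b where "b = (\<Prod>k<n. (\<beta> + t) ^ (?p ^ k * E))"
    have gM: "g \<in> M" using M[OF t] by (simp add: g_def)
    \<comment> \<open>Since \<open>b\<close> is the same for all \<open>i\<close>, the vanishing
      conditions depend on \<open>t\<close> only through \<open>g\<close>, up to evaluation of a
      polynomial that is made identically zero.\<close>
    have T_t: "poly (T i) t = b * g ^ i" if i: "i < d" for i
    proof -
      have "poly (T i) t = (\<Prod>k<n. (\<alpha> + t) ^ (?p ^ k * dig i k)) * (\<Prod>k<n. (\<beta> + t) ^ (?p ^ k * (E - dig i k)))"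
        by (simp add: T_def poly_prod prod_lessThan_add \<gamma>_def ex_def power_mult add_power_CHAR_power[OF t])
      also have "(\<Prod>k<n. (\<alpha> + t) ^ (?p ^ k * dig i k)) = (\<alpha> + t) ^ (i * N)"
        by (simp add: digsum[OF i] flip: power_sum)
      also have "(\<Prod>k<n. (\<beta> + t) ^ (?p ^ k * (E - dig i k))) = b / (\<beta> + t) ^ (i * N)"
      proof -
        have "(\<Prod>k<n. (\<beta> + t) ^ (?p ^ k * (E - dig i k))) * (\<beta> + t) ^ (i * N)
          = (\<Prod>k<n. (\<beta> + t) ^ (?p ^ k * (E - dig i k)) * (\<beta> + t) ^ (?p ^ k * dig i k))"
          by (simp add: digsum[OF i] prod.distrib flip: power_sum)
        also have "\<dots> = b"
          unfolding b_def using dig i by (intro prod.cong) (auto simp flip: power_add distrib_left)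
        finally show ?thesis using nz(2)[OF t] by (simp add: field_simps)
      qed
      finally show ?thesis by (simp add: g_def power_divide mult.commute flip: power_mult)
    qed
    have W_t: "poly W t \<noteq> 0"
    proof -
      have "\<gamma> k + t \<noteq> 0" for k
        using nz(1)[OF t] nz(2)[OF t] by (simp add: \<gamma>_def flip: add_power_CHAR_power[OF t])
      then show ?thesis by (simp add: W_def poly_prod prod_zero_iff)
    qed
    show "L \<le> Polynomial.order t \<Psi>"
    proof (rule order_ge_of_pderivs[OF Lp \<open>\<Psi> \<noteq> 0\<close>])
      fix l assume l: "l < L"
      \<comment> \<open>A p-th power behaves as a constant under differentiation, so
        \<open>j\<close> costs nothing in the higher derivatives.\<close>
      have pB: "pderiv (B ^ (?p * j)) = 0" for j
        by (simp add: pderiv_power)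
      have "W ^ l * (pderiv ^^ l) \<Psi> = (\<Sum>i<d. \<Sum>j<J. B ^ (?p * j) * (T i * scaled_deriv W (u i) l (F c i j)))"
        unfolding \<Psi>_def higher_pderiv_sum higher_pderiv_mult_const[OF pB] sum_distrib_left
          higher_pderiv_eq_scaled_deriv[OF u(2), symmetric] by (simp add: mult_ac)
      then have "poly (W ^ l * (pderiv ^^ l) \<Psi>) t
        = (\<Sum>i<d. \<Sum>j<J. (\<beta> ^ ?p + t) ^ j * (poly (T i) t * poly (scaled_deriv W (u i) l (F c i j)) t))"
        using add_power_CHAR_power[OF t, of \<beta> 1] by (simp add: poly_sum B_def power_mult)
      also have "\<dots> = b * poly (\<Phi> c (g, l)) t"
        unfolding \<Phi>_def by (simp add: poly_sum T_t sum_distrib_left mult_ac)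
      also have "\<dots> = 0" using c gM l by simp
      finally show "poly ((pderiv ^^ l) \<Psi>) t = 0" using W_t by simp
    qed
  qed
  moreover have "card (of_nat ` {..<?p} :: 'a set) = ?p"
  proof -
    have "inj_on (of_nat :: nat \<Rightarrow> 'a) {..<?p}"
      by (auto simp: inj_on_def of_nat_eq_iff_cong_CHAR cong_def)
    then show ?thesis by (simp add: card_image)
  qed
  \<comment> \<open>Since L - (J - 1) = n, this says n p <= A - 1 + n (p - A), which is
    absurd.\<close>
  ultimately have le: "L * ?p \<le> ?p * (J - 1) + (A - 1 + n * E)" by simp
  obtain k where k: "r = Suc k" using r(2) gr0_conv_Suc by blast
  have pE: "?p = E + A" using EA by simp
  show False using le A0 unfolding L_def J_def pE r(1) k by (simp add: algebra_simps)
qed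

subsection \<open>Additive functions with slopes in few cosets\<close>

lemma power_CHAR_power_inj:
  fixes x y :: "'a :: field_prime_char"
  assumes "x ^ (CHAR('a) ^ k) = y ^ (CHAR('a) ^ k)"
  shows "x = y"
proof -
  have "(x - y) ^ (CHAR('a) ^ k) + y ^ (CHAR('a) ^ k) = x ^ (CHAR('a) ^ k)"
    by (subst freshmans_dream'[where n = k, symmetric]) simp_all
  then show ?thesis using assms by simp
qed

text \<open>The translates of \<open>V\<close> by the p prime-field multiples of an outside vector
  are disjoint.\<close>

lemma card_proper_subspace:
  fixes V :: "'a :: finite_field set"
  assumes add: "\<And>x y. x \<in> V \<Longrightarrow> y \<in> V \<Longrightarrow> x + y \<in> V"
    and scale: "\<And>l x. l ^ CHAR('a) = l \<Longrightarrow> x \<in> V \<Longrightarrow> l * x \<in> V"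
    and w: "w \<notin> V"
  shows "CHAR('a) * card V \<le> CARD('a)"
proof -
  have diff_CHAR: "(x - y) ^ CHAR('a) = x - y" if "x ^ CHAR('a) = x" "y ^ CHAR('a) = y" for x y :: 'a
  proof -
    have "(x - y + y) ^ CHAR('a) = (x - y) ^ CHAR('a) + y ^ CHAR('a)"
      by (rule freshmans_dream) simp_all
    then show ?thesis using that by (simp add: eq_diff_eq)
  qed
  have minus: "x - y \<in> V" if "x \<in> V" "y \<in> V" for x y
    using add[OF that(1) scale[of "- 1" y]] that diff_CHAR[of 0 1] by (simp add: power_0_left)
  have "inj_on (\<lambda>(t, v). of_nat t * w + v) ({..<CHAR('a)} \<times> V)"
  proof (rule inj_onI)
    fix s s'
    assume s: "s \<in> {..<CHAR('a)} \<times> V" "s' \<in> {..<CHAR('a)} \<times> V"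
      and "(\<lambda>(t, v). of_nat t * w + v) s = (\<lambda>(t, v). of_nat t * w + v) s'"
    then obtain t v t' v' where ss: "s = (t, v)" "s' = (t', v')"
      and eq: "of_nat t * w + v = of_nat t' * w + v'" by (cases s, cases s') auto
    have t: "t < CHAR('a)" "t' < CHAR('a)" and v: "v \<in> V" "v' \<in> V" using s ss by auto
    define l :: 'a where "l = of_nat t - of_nat t'"
    have l: "(1 / l) ^ CHAR('a) = 1 / l"
      by (simp add: l_def power_divide diff_CHAR of_nat_power_CHAR)
    have "l * w = v' - v" using eq by (simp add: l_def algebra_simps)
    then have "w = 1 / l * (v' - v)" if "l \<noteq> 0" using that by (simp add: field_simps)
    then have "l = 0" using scale[OF l minus[OF v(2,1)]] w by metis
    then have "t = t'" using t by (simp add: l_def of_nat_eq_iff_cong_CHAR cong_def)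
    then show "s = s'" using eq ss by simp
  qed
  then have "card ({..<CHAR('a)} \<times> V) \<le> card (UNIV :: 'a set)"
    by (rule card_inj_on_le) auto
  then show ?thesis by simp
qed

lemma card_fixed_points_power:
  assumes "1 < m"
  shows "card {x :: 'a :: finite_field. x ^ m = x} \<le> m"
proof -
  let ?P = "Polynomial.monom (1 :: 'a) m - Polynomial.monom 1 1"
  have "poly.coeff ?P m = 1" using assms by simp
  then have "?P \<noteq> 0" by (metis coeff_0 zero_neq_one)
  then have "card {x. poly ?P x = 0} \<le> degree ?P" by (rule card_poly_roots_bound)
  also have "\<dots> \<le> m" using assms by (intro degree_diff_le) (auto simp: degree_monom_eq)
  finally show ?thesis by (simp add: poly_monom)
qed

section \<open>Powers on cosets of a multiplicative subgroup\<close>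

lemma subgroup_mult_group_power_card:
  fixes H :: "'a :: finite_field set"
  assumes H: "subgroup H mult_group" and h: "h \<in> H"
  shows "h ^ card H = 1"
proof -
  have H0: "x \<noteq> 0" if "x \<in> H" for x
    using subgroup.subset[OF H] that by (auto simp: carrier_mult_group)
  have "(*) h ` H = H"
  proof (rule endo_inj_surj)
    show "(*) h ` H \<subseteq> H" using subgroup.m_closed[OF H h] by (auto simp: mult_mult_group)
    show "inj_on ((*) h) H" using H0[OF h] by (simp add: inj_on_def)
  qed simp
  then have "\<Prod>H = (\<Prod>x\<in>H. h * x)"
    using prod.reindex[of "(*) h" H id] H0[OF h] by (simp add: inj_on_def)
  also have "\<dots> = h ^ card H * \<Prod>H" by (simp add: prod.distrib)
  finally show ?thesis using H0 by (simp add: prod_zero_iff)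
qed

lemma rcoset_mult_groupE:
  fixes H :: "'a :: finite_field set"
  assumes "R \<in> rcosets\<^bsub>mult_group\<^esub> H"
  obtains a where "a \<noteq> 0" "R = (\<lambda>h. h * a) ` H"
  using assms by (auto simp: RCOSETS_def r_coset_def mult_mult_group carrier_mult_group image_def)

text \<open>Raising to the power \<open>card H\<close> kills \<open>H\<close>, so it is constant on
  each coset; this turns few cosets into few power values.\<close>

lemma union_of_cosets:
  fixes H :: "'a :: finite_field set"
  assumes H: "subgroup H mult_group" and C: "C \<subseteq> rcosets\<^bsub>mult_group\<^esub> H"
  shows "0 \<notin> \<Union>C" and "card (\<Union>C) \<le> card C * card H"
    and "card ((\<lambda>z. z ^ card H) ` \<Union>C) \<le> card C"
proof -
  have H0: "x \<noteq> 0" if "x \<in> H" for x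
    using subgroup.subset[OF H] that by (auto simp: carrier_mult_group)
  have R: "0 \<notin> R" "card R \<le> card H" "\<exists>b. (\<lambda>z. z ^ card H) ` R \<subseteq> {b}" if "R \<in> C" for R
  proof -
    have "R \<in> rcosets\<^bsub>mult_group\<^esub> H" using C that by blast
    then obtain a where a: "a \<noteq> 0" "R = (\<lambda>h. h * a) ` H" by (rule rcoset_mult_groupE)
    show "0 \<notin> R" using a H0 by auto
    show "card R \<le> card H" unfolding a(2) by (rule card_image_le) simp
    show "\<exists>b. (\<lambda>z. z ^ card H) ` R \<subseteq> {b}"
      by (intro exI[of _ "a ^ card H"])
         (auto simp: a(2) power_mult_distrib subgroup_mult_group_power_card[OF H])
  qed
  show "0 \<notin> \<Union>C" using R(1) by blast
  have "card (\<Union>C) \<le> sum card C" by (rule card_Union_le_sum_card)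
  also have "\<dots> \<le> card C * card H" using sum_bounded_above[of C card "card H"] R(2) by simp
  finally show "card (\<Union>C) \<le> card C * card H" .
  have "(\<lambda>z. z ^ card H) ` \<Union>C = (\<Union>R\<in>C. (\<lambda>z. z ^ card H) ` R)" by auto
  also have "card \<dots> \<le> (\<Sum>R\<in>C. card ((\<lambda>z. z ^ card H) ` R))" by (rule card_UN_le) simp
  also have "\<dots> \<le> (\<Sum>R\<in>C. 1)"
  proof (rule sum_mono)
    fix R assume "R \<in> C"
    then obtain b where "(\<lambda>z. z ^ card H) ` R \<subseteq> {b}" using R(3) by blast
    then show "card ((\<lambda>z. z ^ card H) ` R) \<le> 1" using card_mono[of "{b}"] by simp
  qed
  finally show "card ((\<lambda>z. z ^ card H) ` \<Union>C) \<le> card C" by simp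
qed

theorem corollary1p5:
  fixes n d p :: nat
    and H D :: "'a :: finite_field set"
    and C :: "'a set set"
    and f :: "'a \<Rightarrow> 'a"
  assumes "n \<ge> 2" and "d \<ge> 2"
    and "Factorial_Ring.prime p"
    and "CARD('a) = p ^ n"
    and "[p ^ n = 1] (mod d)"
    and "p \<ge> 2 * (2 * n - 1)\<^sup>2 * d"
    and "subgroup H mult_group"
    and "card (rcosets\<^bsub>mult_group\<^esub> H) = d"
    and "C \<subseteq> rcosets\<^bsub>mult_group\<^esub> H"
    and "real (card C) \<le> real d / 2"
    and "D = \<Union>C"
    and "directions f \<subseteq> D"
  shows "\<exists>a b :: 'a. \<exists>j :: nat. j \<le> n - 1 \<and> (\<forall>x. f x = a * x ^ (p ^ j) + b)"
proof -
  have pC: "p = CHAR('a)"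
  proof -
    have "CHAR('a) dvd p ^ n" using CHAR_dvd_CARD[where 'a = 'a] assms(4) by simp
    then have "CHAR('a) dvd p" by (rule prime_dvd_power[OF CHAR_prime])
    then show ?thesis using primes_dvd_imp_eq[OF CHAR_prime[where 'a = 'a] assms(3)] by simp
  qed
  note q = assms(4)[unfolded pC] and p_ge = assms(6)[unfolded pC]
  let ?p = "CHAR('a)" and ?N = "card H"
  have dN: "d * ?N = CARD('a) - 1"
    using group.lagrange[OF group_mult_group assms(7)] assms(8)
    by (simp add: Coset.order_def carrier_mult_group card_Diff_singleton)
  have cC: "2 * card C \<le> d" using assms(10) by linarith
  have D0: "0 \<notin> D" and cD: "card D \<le> card C * ?N" and cDN: "card ((\<lambda>z. z ^ ?N) ` D) \<le> card C"
    using union_of_cosets[OF assms(7,9)] by (simp_all add: assms(11))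
  have p_large: "2 * n - 1 < ?p" "5 \<le> ?p"
  proof -
    have "3 \<le> 2 * n - 1" using assms(1) by simp
    then have "9 \<le> (2 * n - 1)\<^sup>2" "2 * n - 1 \<le> (2 * n - 1)\<^sup>2"
      using power_mono[of 3 "2 * n - 1" 2] by (simp_all add: power2_eq_square)
    moreover have "2 * (2 * n - 1)\<^sup>2 * 1 \<le> 2 * (2 * n - 1)\<^sup>2 * d" using assms(2) by (intro mult_le_mono2) simp
    ultimately show "2 * n - 1 < ?p" "5 \<le> ?p" using p_ge by linarith+
  qed
  have "2 * card (directions f) \<le> 2 * card D"
    using assms(12) by (simp add: card_mono)
  also have "\<dots> \<le> d * ?N" using cD mult_le_mono1[OF cC, of ?N] by linarith
  also have "\<dots> < CARD('a)" unfolding dN by simp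
  finally have dirs: "2 * card (directions f) < CARD('a)" .

  define g where "g x = f x - f 0" for x
  have comb: "g (x + l * (z - x)) = g x + l * (g z - g x)" if "l ^ ?p = l" for x z l
    using affine_combination[OF q dirs p_large(2) that, of x z] by (simp add: g_def)
  have g0: "g 0 = 0" by (simp add: g_def)
  have scale: "g (l * x) = l * g x" if "l ^ ?p = l" for x l
    using comb[OF that, of 0 x] by (simp add: g0)
  \<comment> \<open>The sum is twice the midpoint, and both 2 and 1 / 2 lie in the prime
    field.\<close>
  have add: "g (x + z) = g x + g z" for x z
  proof -
    have two: "(2 :: 'a) \<noteq> 0"
      using p_large of_nat_eq_0_iff_char_dvd[where 'a = 'a, of 2] by (auto dest: dvd_imp_le)
    have p2: "(2 :: 'a) ^ ?p = 2" using of_nat_power_CHAR[where 'a = 'a, of 2] by simp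
    have mid: "2 * (u + (1 / 2) * (v - u)) = u + v" for u v :: 'a
    proof -
      have "2 * (u + (1 / 2) * (v - u)) = 2 * u + (2 * (1 / 2)) * (v - u)"
        by (simp only: distrib_left mult.assoc)
      also have "(2 :: 'a) * (1 / 2) = 1" using two by simp
      finally show ?thesis by (simp only: mult_2 mult_1) simp
    qed
    have "g (x + z) = 2 * g (x + (1 / 2) * (z - x))" by (simp only: mid flip: scale[OF p2])
    also have "\<dots> = g x + g z"
      by (subst comb) (simp_all only: mid, simp add: power_divide p2)
    finally show ?thesis .
  qed
  have slope: "g x / x \<in> D" if "x \<noteq> 0" for x
  proof -
    have "(f x - f 0) / (x - 0) \<in> directions f" unfolding directions_def using that by blast
    then show ?thesis using assms(12) by (auto simp: g_def)
  qed
  have g_nz: "g x \<noteq> 0" if "x \<noteq> 0" for x using slope[OF that] D0 by auto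
  define a where "a = g 1"
  have a: "a \<noteq> 0" using g_nz by (simp add: a_def)

  have conj: "\<exists>k<n. g \<beta> = a * \<beta> ^ (?p ^ k)" if inj: "inj_on (\<lambda>k. \<beta> ^ (?p ^ k)) {..<n}" for \<beta>
  proof -
    \<comment> \<open>Otherwise \<open>\<beta>\<close> would be fixed by Frobenius, against
      injectivity at the indices 0 and 1.\<close>
    have nz: "\<beta> + t \<noteq> 0" if "t ^ ?p = t" for t
    proof
      assume "\<beta> + t = 0"
      then have "\<beta> ^ (?p ^ 1) + t = 0" using add_power_CHAR_power[OF that, of \<beta> 1] by (simp add: power_0_left)
      then have "\<beta> ^ (?p ^ 1) = \<beta> ^ (?p ^ 0)" using \<open>\<beta> + t = 0\<close> by (simp add: add_eq_0_iff2)
      then show False using inj_onD[OF inj, of 1 0] assms(1) by simp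
    qed
    have gt: "g \<beta> / a + t = g (\<beta> + t) / a" if "t ^ ?p = t" for t
      using add[of \<beta> t] scale[OF that, of 1] a by (simp add: a_def field_simps)
    have "\<exists>k<n. g \<beta> / a = \<beta> ^ (?p ^ k)"
    proof (rule coset_values_imp_conjugate[OF q assms(1) _ p_ge dN _ _ _ nz inj])
      show "0 < d" using assms(2) by simp
      \<comment> \<open>Dividing \<open>g\<close> by \<open>a\<close> normalises its value at 1; it
        rescales the power values without adding any.\<close>
      let ?M = "(\<lambda>z. z / a ^ ?N) ` (\<lambda>z. z ^ ?N) ` D"
      have "card ?M \<le> card ((\<lambda>z. z ^ ?N) ` D)" by (rule card_image_le) simp
      then show "2 * card ?M \<le> d" using cDN cC by linarith
      fix t :: 'a assume t: "t ^ ?p = t"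
      show "g \<beta> / a + t \<noteq> 0" using gt[OF t] g_nz[OF nz[OF t]] a by simp
      have "(g \<beta> / a + t) / (\<beta> + t) = (g (\<beta> + t) / (\<beta> + t)) / a" by (simp add: gt[OF t])
      then show "((g \<beta> / a + t) / (\<beta> + t)) ^ ?N \<in> ?M"
        using slope[OF nz[OF t]] by (simp only: power_divide[of _ a]) blast
    qed
    then show ?thesis using a by (auto simp: field_simps)
  qed

  define V where "V k = {x. g x = a * x ^ (?p ^ k)}" for k
  define Z where "Z k = {x :: 'a. x ^ (?p ^ k) = x}" for k
  have cover: "UNIV \<subseteq> (\<Union>k<n. V k) \<union> (\<Union>k\<in>{1..<n}. Z k)"
  proof
    fix \<beta> :: 'a
    show "\<beta> \<in> (\<Union>k<n. V k) \<union> (\<Union>k\<in>{1..<n}. Z k)"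
    proof (cases "inj_on (\<lambda>k. \<beta> ^ (?p ^ k)) {..<n}")
      case True
      then show ?thesis using conj by (auto simp: V_def)
    next
      case False
      then obtain k l where kl: "k < l" "l < n" "\<beta> ^ (?p ^ k) = \<beta> ^ (?p ^ l)"
        unfolding inj_on_def by (metis lessThan_iff nat_neq_iff)
      \<comment> \<open>Two equal conjugates, by injectivity of Frobenius, place
        \<open>\<beta>\<close> in a proper subfield.\<close>
      have "(\<beta> ^ (?p ^ (l - k))) ^ (?p ^ k) = \<beta> ^ (?p ^ k)"
        using kl by (simp flip: power_mult power_add)
      then have "\<beta> \<in> Z (l - k)" unfolding Z_def using power_CHAR_power_inj by blast
      moreover have "l - k \<in> {1..<n}" using kl by auto
      ultimately show ?thesis by blast
    qed
  qed
  have "\<exists>k<n. V k = UNIV"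
  proof (rule ccontr)
    assume no: "\<not> (\<exists>k<n. V k = UNIV)"
    have pn: "?p ^ n = ?p * ?p ^ (n - 1)" using assms(1) by (cases n) auto
    have V: "card (V k) \<le> ?p ^ (n - 1)" if k: "k < n" for k
    proof -
      obtain w where w: "w \<notin> V k" using no k by blast
      have frob: "(x + y) ^ (?p ^ k) = x ^ (?p ^ k) + y ^ (?p ^ k)" for x y :: 'a
        by (rule freshmans_dream'[where n = k]) simp_all
      have "?p * card (V k) \<le> ?p * ?p ^ (n - 1)"
        unfolding pn[symmetric] q[symmetric]
      proof (rule card_proper_subspace[OF _ _ w])
        fix x y assume "x \<in> V k" "y \<in> V k"
        then show "x + y \<in> V k" by (simp add: V_def add frob distrib_left)
      next
        fix l x :: 'a assume l: "l ^ ?p = l" and x: "x \<in> V k"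
        have "l ^ (?p ^ k) = l" using add_power_CHAR_power[OF l, of 0 k] by (simp add: power_0_left)
        then show "l * x \<in> V k" using x scale[OF l] by (simp add: V_def power_mult_distrib)
      qed
      then show ?thesis by simp
    qed
    have Z: "card (Z k) \<le> ?p ^ (n - 1)" if "k \<in> {1..<n}" for k
    proof -
      have "1 < ?p ^ k" using that p_large by (intro one_less_power) auto
      then have "card (Z k) \<le> ?p ^ k"
        unfolding Z_def by (rule card_fixed_points_power)
      also have "\<dots> \<le> ?p ^ (n - 1)" using that p_large by (intro power_increasing) auto
      finally show ?thesis .
    qed
    \<comment> \<open>There are \<open>n\<close> sets \<open>V k\<close> and n - 1 sets
      \<open>Z k\<close>, each with at most q / p elements; 2 n - 1 < p prevents them from
      covering.\<close>
    have "CARD('a) \<le> card ((\<Union>k<n. V k) \<union> (\<Union>k\<in>{1..<n}. Z k))" using cover by (intro card_mono) auto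
    also have "\<dots> \<le> card (\<Union>k<n. V k) + card (\<Union>k\<in>{1..<n}. Z k)" by (rule card_Un_le)
    also have "\<dots> \<le> (\<Sum>k<n. card (V k)) + (\<Sum>k\<in>{1..<n}. card (Z k))"
      by (intro add_mono card_UN_le) auto
    also have "\<dots> \<le> (\<Sum>k<n. ?p ^ (n - 1)) + (\<Sum>k\<in>{1..<n}. ?p ^ (n - 1))"
      using V Z by (intro add_mono sum_mono) auto
    also have "\<dots> = (2 * n - 1) * ?p ^ (n - 1)"
      using assms(1) by (simp flip: add_mult_distrib)
    also have "\<dots> < ?p * ?p ^ (n - 1)" using p_large by (intro mult_strict_right_mono) auto
    finally show False using q pn by simp
  qed
  then obtain k where k: "k < n" "V k = UNIV" by blast
  have "f x = a * x ^ (p ^ k) + f 0" for x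
  proof -
    have "x \<in> V k" using k(2) by simp
    then show ?thesis by (simp add: V_def g_def pC diff_eq_eq)
  qed
  moreover have "k \<le> n - 1" using k(1) by simp
  ultimately show ?thesis by blast
qed

end
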